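(* Let $I,J\subseteq[n]$ be subsets such that $J$ surrounds $I$. Then the quantum minors $[\![J]\!]$ and $[\![I]\!]$ of the $n\times n$ $q$-generic matrix $X$ $q$-commute; specifically, $$[\![J]\!]\,[\![I]\!] = q^{\langle\langle J,I\rangle\rangle}\,[\![I]\!]\,[\![J]\!].$$
   Context: $[n]=\{1,\dots,n\}$. Fix a field $\Bbbk$ of characteristic $0$ and an invertible $q\in\Bbbk$ that is not a root of unity. An $n\times n$ matrix $X=(x_{ab})$ is $q$-generic if its entries satisfy (1) $x_{il}x_{ik}=q\,x_{ik}x_{il}$ for all $i$ and all $k<l$; (2) $x_{jk}x_{ik}=q\,x_{ik}x_{jk}$ for all $i<j$ and all $k$; (3) $x_{jk}x_{il}=x_{il}x_{jk}$ for all $i<j$, $k<l$; (4) $x_{jl}x_{ik}=x_{ik}x_{jl}+(q-q^{-1})x_{il}x_{jk}$ for all $i<j$, $k<l$. $\mathrm{M}_q(n)$ is the $\Bbbk$-algebra with $n^2$ generators $x_{ab}$ subject to the relations making $X=(x_{ab})$ a $q$-generic matrix. For a subset $I=\{i_1<\dots<i_d\}\subseteq[n]$, the quantum minor $[\![I]\!]$ is the quantum determinant of the submatrix of $X$ with row-set $I$ and column-set $\{1,\dots,d\}$: $$[\![I]\!]=\sum_{\sigma\in\mathfrak S_d}(-q)^{-\ell(\sigma)}x_{i_{\sigma(1)},1}x_{i_{\sigma(2)},2}\cdots x_{i_{\sigma(d)},d},$$ where $\ell(\sigma)$ is the number of inversions of $\sigma$. Given $I,J\subseteq[n]$, we say $J$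 surrounds $I$ if (i) $|J|\le|I|$, and (ii) there exist disjoint (possibly empty) subsets $J',J''\subseteq J$ such that: (a) $J\setminus I=J'\,\dot\cup\,J''$ (disjoint union); (b) $j'<i$ for all $j'\in J'$ and $i\in I\setminus J$; (c) $i<j''$ for all $i\in I\setminus J$ and $j''\in J''$. In this case $\langle\langle J,I\rangle\rangle:=|J''|-|J'|$. *)

theory Defs
  imports "HOL-Library.Poly_Mapping" "HOL-Combinatorics.Permutations"
    "HOL-Algebra.QuotRing" "HOL-Algebra.Module"
begin

section \<open>Free algebras and their quotients\<close>

text \<open>Words are written additively because the convolution product of \<^typ>\<open>'a \<Rightarrow>\<^sub>0 'k\<close> needs
  a \<^class>\<open>monoid_add\<close> structure on \<^typ>\<open>'a\<close>; addition is concatenation and is not commutative.\<close>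

datatype 'x word = Word (letters: "'x list")

instantiation word :: (type) monoid_add
begin

definition zero_word :: "'a word" where "0 = Word []"

definition plus_word :: "'a word \<Rightarrow> 'a word \<Rightarrow> 'a word"
  where "u + v = Word (letters u @ letters v)"

instance
  by standard (simp_all add: zero_word_def plus_word_def)

end

definition free_algebra :: "'x set \<Rightarrow> ('k::field, 'x word \<Rightarrow>\<^sub>0 'k) module"
  where "free_algebra S =
    \<lparr>carrier = {f. \<forall>w\<in>Poly_Mapping.keys f. set (letters w) \<subseteq> S},
     mult = (*), one = 1, zero = 0, add = (+),
     smult = (\<lambda>c f. Poly_Mapping.single 0 c * f)\<rparr>"

definition letter :: "'x \<Rightarrow> ('x word \<Rightarrow>\<^sub>0 'k::field)"
  where "letter x = Poly_Mapping.single (Word [x]) 1"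

lemma free_algebra_simps [simp]:
  "carrier (free_algebra S) = {f. \<forall>w\<in>Poly_Mapping.keys f. set (letters w) \<subseteq> S}"
  "f \<otimes>\<^bsub>free_algebra S\<^esub> g = f * g" "\<one>\<^bsub>free_algebra S\<^esub> = 1"
  "f \<oplus>\<^bsub>free_algebra S\<^esub> g = f + g" "\<zero>\<^bsub>free_algebra S\<^esub> = 0"
  "c \<odot>\<^bsub>free_algebra S\<^esub> f = Poly_Mapping.single 0 c * f"
  by (simp_all add: free_algebra_def)

lemma ring_free_algebra:
  fixes S :: "'x set"
  shows "ring (free_algebra S :: ('k::field, 'x word \<Rightarrow>\<^sub>0 'k) module)"
proof -
  let ?F = "free_algebra S :: ('k, 'x word \<Rightarrow>\<^sub>0 'k) module"
  have plus: "f + g \<in> carrier ?F"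
    if "f \<in> carrier ?F" "g \<in> carrier ?F" for f g
    using that Poly_Mapping.keys_add[of f g] by auto
  have mult: "f * g \<in> carrier ?F"
    if "f \<in> carrier ?F" "g \<in> carrier ?F" for f g
  proof -
    have "set (letters w) \<subseteq> S" if w: "w \<in> Poly_Mapping.keys (f * g)" for w
    proof -
      obtain u v where "w = u + v" "u \<in> Poly_Mapping.keys f" "v \<in> Poly_Mapping.keys g"
        using w keys_mult[of f g] by blast
      then show ?thesis
        using \<open>f \<in> _\<close> \<open>g \<in> _\<close> by (auto simp: plus_word_def)
    qed
    then show ?thesis by simp
  qed
  have inv: "\<exists>g\<in>carrier ?F. f + g = 0"
    if "f \<in> carrier ?F" for f
    using that by (intro bexI[of _ "- f"]) auto
  have const: "0 \<in> carrier ?F" "1 \<in> carrier ?F"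
    by (simp_all add: zero_word_def)
  note [simp del] = free_algebra_simps(1)
  show ?thesis
  proof (rule ringI)
    show "abelian_group ?F"
      by (rule abelian_groupI) (simp_all add: plus inv const add.assoc add.commute)
    show "Group.monoid ?F"
      by (rule monoidI) (simp_all add: mult const mult.assoc)
  qed (simp_all add: distrib_left distrib_right)
qed

lemma letter_in_carrier: "x \<in> S \<Longrightarrow> letter x \<in> carrier (free_algebra S)"
  by (simp add: letter_def)

text \<open>\<^const>\<open>FactRing\<close> together with the induced scalar multiplication.\<close>

definition quotient_algebra :: "('k, 'a, 'm) module_scheme \<Rightarrow> 'a set \<Rightarrow> ('k, 'a set) module"
  where "quotient_algebra A I =
    ring.extend (A Quot I) (module.fields (\<lambda>c C. \<Union>a\<in>C. I +>\<^bsub>A\<^esub> (c \<odot>\<^bsub>A\<^esub> a)))"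

lemma quotient_algebra_simps [simp]:
  "carrier (quotient_algebra A I) = carrier (A Quot I)"
  "C \<otimes>\<^bsub>quotient_algebra A I\<^esub> D = C \<otimes>\<^bsub>A Quot I\<^esub> D"
  "\<one>\<^bsub>quotient_algebra A I\<^esub> = \<one>\<^bsub>A Quot I\<^esub>"
  "C \<oplus>\<^bsub>quotient_algebra A I\<^esub> D = C \<oplus>\<^bsub>A Quot I\<^esub> D"
  "\<zero>\<^bsub>quotient_algebra A I\<^esub> = \<zero>\<^bsub>A Quot I\<^esub>"
  "c \<odot>\<^bsub>quotient_algebra A I\<^esub> C = (\<Union>a\<in>C. I +>\<^bsub>A\<^esub> (c \<odot>\<^bsub>A\<^esub> a))"
  by (simp_all add: quotient_algebra_def ring.defs module.defs)


section \<open>Generic matrices and the quantum matrix algebra\<close>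

text \<open>The defining relations for an \<open>n \<times> n\<close> matrix \<open>X\<close> over the algebra \<open>A\<close>, each one as the pair
  of its two sides.\<close>

definition q_relations ::
    "('k::field, 'a, 'm) module_scheme \<Rightarrow> nat \<Rightarrow> 'k \<Rightarrow> (nat \<Rightarrow> nat \<Rightarrow> 'a) \<Rightarrow> ('a \<times> 'a) set"
  where "q_relations A n q X =
    {(X i l \<otimes>\<^bsub>A\<^esub> X i k, q \<odot>\<^bsub>A\<^esub> (X i k \<otimes>\<^bsub>A\<^esub> X i l)) | i k l.
        i \<in> {1..n} \<and> k \<in> {1..n} \<and> l \<in> {1..n} \<and> k < l} \<union>
    {(X j k \<otimes>\<^bsub>A\<^esub> X i k, q \<odot>\<^bsub>A\<^esub> (X i k \<otimes>\<^bsub>A\<^esub> X j k)) | i j k.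
        i \<in> {1..n} \<and> j \<in> {1..n} \<and> k \<in> {1..n} \<and> i < j} \<union>
    {(X j k \<otimes>\<^bsub>A\<^esub> X i l, X i l \<otimes>\<^bsub>A\<^esub> X j k) | i j k l.
        i \<in> {1..n} \<and> j \<in> {1..n} \<and> k \<in> {1..n} \<and> l \<in> {1..n} \<and> i < j \<and> k < l} \<union>
    {(X j l \<otimes>\<^bsub>A\<^esub> X i k,
      X i k \<otimes>\<^bsub>A\<^esub> X j l \<oplus>\<^bsub>A\<^esub> (q - inverse q) \<odot>\<^bsub>A\<^esub> (X i l \<otimes>\<^bsub>A\<^esub> X j k)) | i j k l.
        i \<in> {1..n} \<and> j \<in> {1..n} \<and> k \<in> {1..n} \<and> l \<in> {1..n} \<and> i < j \<and> k < l}"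

definition q_generic ::
    "('k::field, 'a, 'm) module_scheme \<Rightarrow> nat \<Rightarrow> 'k \<Rightarrow> (nat \<Rightarrow> nat \<Rightarrow> 'a) \<Rightarrow> bool"
  where "q_generic A n q X \<longleftrightarrow>
    (\<forall>a\<in>{1..n}. \<forall>b\<in>{1..n}. X a b \<in> carrier A) \<and> (\<forall>(l, r)\<in>q_relations A n q X. l = r)"

abbreviation free_matrix_algebra :: "nat \<Rightarrow> ('k::field, (nat \<times> nat) word \<Rightarrow>\<^sub>0 'k) module"
  where "free_matrix_algebra n \<equiv> free_algebra ({1..n} \<times> {1..n})"

definition q_ideal :: "nat \<Rightarrow> 'k::field \<Rightarrow> ((nat \<times> nat) word \<Rightarrow>\<^sub>0 'k) set"
  where "q_ideal n q = Idl\<^bsub>free_matrix_algebra n\<^esub>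
    {l - r | l r. (l, r) \<in> q_relations (free_matrix_algebra n) n q (\<lambda>a b. letter (a, b))}"

definition Mq :: "nat \<Rightarrow> 'k::field \<Rightarrow> ('k, ((nat \<times> nat) word \<Rightarrow>\<^sub>0 'k) set) module"
  where "Mq n q = quotient_algebra (free_matrix_algebra n) (q_ideal n q)"

definition Mq_gen :: "nat \<Rightarrow> 'k::field \<Rightarrow> nat \<Rightarrow> nat \<Rightarrow> ((nat \<times> nat) word \<Rightarrow>\<^sub>0 'k) set"
  where "Mq_gen n q a b = q_ideal n q +>\<^bsub>free_matrix_algebra n\<^esub> letter (a, b)"

lemma ideal_q_ideal: "ideal (q_ideal n q) (free_matrix_algebra n)"
  and q_relations_in_q_ideal:
    "(l, r) \<in> q_relations (free_matrix_algebra n) n q (\<lambda>a b. letter (a, b)) \<Longrightarrow> l - r \<in> q_ideal n q"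
proof -
  let ?F = "free_matrix_algebra n :: ('a, _) module"
  let ?G = "{l - r | l r. (l, r) \<in> q_relations ?F n q (\<lambda>a b. letter (a, b))}"
  interpret F: ring ?F by (rule ring_free_algebra)
  have x: "letter (a, b) \<in> carrier ?F" if "a \<in> {1..n}" "b \<in> {1..n}" for a b
    using that by (intro letter_in_carrier) auto
  have c: "Poly_Mapping.single 0 c \<in> carrier ?F" for c
    by (simp add: zero_word_def)
  have closed: "f * g \<in> carrier ?F" "f + g \<in> carrier ?F" "f - g \<in> carrier ?F"
    if "f \<in> carrier ?F" "g \<in> carrier ?F" for f g
  proof -
    show "f * g \<in> carrier ?F" "f + g \<in> carrier ?F"
      using F.m_closed[OF that] F.a_closed[OF that] by simp_all
    have "- g \<in> carrier ?F" using that by simp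
    then show "f - g \<in> carrier ?F"
      using F.a_closed[OF that(1), of "- g"] by simp
  qed
  have sub: "?G \<subseteq> carrier ?F"
    unfolding q_relations_def free_algebra_simps(2,4,6)
    by (auto intro!: closed x c simp del: free_algebra_simps(1) atLeastAtMost_iff One_nat_def)
  show "ideal (q_ideal n q) ?F"
    unfolding q_ideal_def by (rule F.genideal_ideal[OF sub])
  show "l - r \<in> q_ideal n q" if "(l, r) \<in> q_relations ?F n q (\<lambda>a b. letter (a, b))"
    using that F.genideal_self[OF sub] unfolding q_ideal_def by blast
qed

lemma ring_Mq: "ring (Mq n q)"
proof -
  interpret Q: ring "free_matrix_algebra n Quot q_ideal n q"
    by (rule ideal.quotient_is_ring[OF ideal_q_ideal])
  show ?thesis
    unfolding Mq_def
  proof (rule ringI, unfold quotient_algebra_simps)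
    show "abelian_group (quotient_algebra (free_matrix_algebra n) (q_ideal n q))"
      by (rule abelian_groupI, unfold quotient_algebra_simps)
         (fact Q.a_closed Q.zero_closed Q.a_assoc Q.a_comm Q.l_zero
           | rule bexI, erule Q.l_neg, erule Q.a_inv_closed)+
    show "Group.monoid (quotient_algebra (free_matrix_algebra n) (q_ideal n q))"
      by (rule monoidI, unfold quotient_algebra_simps)
         (fact Q.m_closed Q.one_closed Q.m_assoc Q.l_one Q.r_one)+
  qed (fact Q.l_distr Q.r_distr)+
qed

lemma Mq_smult_coset:
  assumes "f \<in> carrier (free_matrix_algebra n)"
  shows "c \<odot>\<^bsub>Mq n q\<^esub> (q_ideal n q +>\<^bsub>free_matrix_algebra n\<^esub> f) =
    q_ideal n q +>\<^bsub>free_matrix_algebra n\<^esub> (Poly_Mapping.single 0 c * f)"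
proof -
  let ?F = "free_matrix_algebra n :: ('a, _) module" and ?I = "q_ideal n q"
  interpret ideal ?I ?F by (rule ideal_q_ideal)
  let ?c = "Poly_Mapping.single 0 c"
  have c: "?c \<in> carrier ?F"
    by (simp add: zero_word_def)
  have cf: "?c * f \<in> carrier ?F"
    using m_closed[OF c assms] by simp
  have "?I +>\<^bsub>?F\<^esub> (?c * a) = ?I +>\<^bsub>?F\<^esub> (?c * f)" if a: "a \<in> ?I +>\<^bsub>?F\<^esub> f" for a
  proof -
    obtain h where h: "h \<in> ?I" "a = h + f"
      using a unfolding a_r_coset_def' by auto
    have "?c * h \<in> ?I"
      using I_l_closed[OF h(1) c] by simp
    then have "?c * a \<in> ?I +>\<^bsub>?F\<^esub> (?c * f)"
      using h(2) unfolding a_r_coset_def' by (auto simp: distrib_left)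
    then show ?thesis
      using a_repr_independence cf a_subgroup by metis
  qed
  moreover have "f \<in> ?I +>\<^bsub>?F\<^esub> f"
    using a_rcos_self[OF assms] .
  ultimately show ?thesis
    unfolding Mq_def quotient_algebra_simps free_algebra_simps by blast
qed

lemma q_generic_Mq_gen: "q_generic (Mq n q) n q (Mq_gen n q)"
proof -
  let ?F = "free_matrix_algebra n :: ('a, _) module" and ?I = "q_ideal n q"
  let ?x = "\<lambda>a b. letter (a, b) :: _ \<Rightarrow>\<^sub>0 'a" and ?\<pi> = "\<lambda>f. ?I +>\<^bsub>?F\<^esub> f"
  interpret ideal ?I ?F by (rule ideal_q_ideal)
  have x: "?x a b \<in> carrier ?F" if "a \<in> {1..n}" "b \<in> {1..n}" for a b
    using that by (intro letter_in_carrier) auto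
  have c: "Poly_Mapping.single 0 c \<in> carrier ?F" for c
    by (simp add: zero_word_def)
  have mem: "f * g \<in> carrier ?F" "f + g \<in> carrier ?F"
    if "f \<in> carrier ?F" "g \<in> carrier ?F" for f g
    using m_closed[OF that] a_closed[OF that] by simp_all
  have mult: "?\<pi> f \<otimes>\<^bsub>Mq n q\<^esub> ?\<pi> g = ?\<pi> (f * g)" and add: "?\<pi> f \<oplus>\<^bsub>Mq n q\<^esub> ?\<pi> g = ?\<pi> (f + g)"
    if "f \<in> carrier ?F" "g \<in> carrier ?F" for f g
    using rcoset_mult_add[OF that] a_rcos_sum[OF that]
    by (simp_all add: Mq_def FactRing_def)
  have smult: "c \<odot>\<^bsub>Mq n q\<^esub> ?\<pi> f = ?\<pi> (Poly_Mapping.single 0 c * f)" if "f \<in> carrier ?F" for c f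
    using Mq_smult_coset[OF that] .
  have eq: "?\<pi> l = ?\<pi> r"
    if "(l, r) \<in> q_relations ?F n q ?x" "r \<in> carrier ?F" for l r
  proof -
    have "l \<in> ?\<pi> r"
      using q_relations_in_q_ideal[OF that(1)]
      by (auto simp: a_r_coset_def r_coset_def intro!: bexI[of _ "l - r"])
    then show ?thesis
      using a_repr_independence that(2) a_subgroup by metis
  qed
  have 1: "?\<pi> (?x a b) \<in> carrier (Mq n q)" if "a \<in> {1..n}" "b \<in> {1..n}" for a b
    using x[OF that] by (auto simp: Mq_def FactRing_def A_RCOSETS_def RCOSETS_def a_r_coset_def)
  note [simp] = mult add smult x c mem
  note [simp del] = free_algebra_simps(1) atLeastAtMost_iff One_nat_def
  let ?X = "Mq_gen n q"
  have "?X i l \<otimes>\<^bsub>Mq n q\<^esub> ?X i k = q \<odot>\<^bsub>Mq n q\<^esub> (?X i k \<otimes>\<^bsub>Mq n q\<^esub> ?X i l)"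
    if *: "i \<in> {1..n}" "k \<in> {1..n}" "l \<in> {1..n}" "k < l" for i k l
  proof -
    have "(?x i l * ?x i k, Poly_Mapping.single 0 q * (?x i k * ?x i l)) \<in> q_relations ?F n q ?x"
      unfolding q_relations_def free_algebra_simps(2,4,6) using * by blast
    from eq[OF this] * show ?thesis by (simp add: Mq_gen_def)
  qed
  moreover have "?X j k \<otimes>\<^bsub>Mq n q\<^esub> ?X i k = q \<odot>\<^bsub>Mq n q\<^esub> (?X i k \<otimes>\<^bsub>Mq n q\<^esub> ?X j k)"
    if *: "i \<in> {1..n}" "j \<in> {1..n}" "k \<in> {1..n}" "i < j" for i j k
  proof -
    have "(?x j k * ?x i k, Poly_Mapping.single 0 q * (?x i k * ?x j k)) \<in> q_relations ?F n q ?x"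
      unfolding q_relations_def free_algebra_simps(2,4,6) using * by blast
    from eq[OF this] * show ?thesis by (simp add: Mq_gen_def)
  qed
  moreover have "?X j k \<otimes>\<^bsub>Mq n q\<^esub> ?X i l = ?X i l \<otimes>\<^bsub>Mq n q\<^esub> ?X j k"
    if *: "i \<in> {1..n}" "j \<in> {1..n}" "k \<in> {1..n}" "l \<in> {1..n}" "i < j" "k < l" for i j k l
  proof -
    have "(?x j k * ?x i l, ?x i l * ?x j k) \<in> q_relations ?F n q ?x"
      unfolding q_relations_def free_algebra_simps(2,4,6) using * by blast
    from eq[OF this] * show ?thesis by (simp add: Mq_gen_def)
  qed
  moreover have "?X j l \<otimes>\<^bsub>Mq n q\<^esub> ?X i k =
      ?X i k \<otimes>\<^bsub>Mq n q\<^esub> ?X j l \<oplus>\<^bsub>Mq n q\<^esub> (q - inverse q) \<odot>\<^bsub>Mq n q\<^esub> (?X i l \<otimes>\<^bsub>Mq n q\<^esub> ?X j k)"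
    if *: "i \<in> {1..n}" "j \<in> {1..n}" "k \<in> {1..n}" "l \<in> {1..n}" "i < j" "k < l" for i j k l
  proof -
    have "(?x j l * ?x i k,
        ?x i k * ?x j l + Poly_Mapping.single 0 (q - inverse q) * (?x i l * ?x j k))
      \<in> q_relations ?F n q ?x"
      unfolding q_relations_def free_algebra_simps(2,4,6) using * by blast
    from eq[OF this] * show ?thesis by (simp add: Mq_gen_def)
  qed
  ultimately have "\<forall>(l, r)\<in>q_relations (Mq n q) n q ?X. l = r"
    unfolding q_relations_def ball_Un by (intro conjI; clarify)
  moreover have "\<forall>a\<in>{1..n}. \<forall>b\<in>{1..n}. ?X a b \<in> carrier (Mq n q)"
    using 1 by (simp add: Mq_gen_def)
  ultimately show ?thesis
    unfolding q_generic_def by blast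
qed


section \<open>Quantum minors\<close>

definition inversion_number :: "nat \<Rightarrow> (nat \<Rightarrow> nat) \<Rightarrow> nat"
  where "inversion_number d \<sigma> =
    card {(a, b). a \<in> {1..d} \<and> b \<in> {1..d} \<and> a < b \<and> \<sigma> a > \<sigma> b}"

text \<open>Lists are indexed from \<open>0\<close>, so the \<open>k\<close>-th smallest element of \<open>I\<close> is
  \<open>sorted_list_of_set I ! (k - 1)\<close>.\<close>

definition quantum_minor ::
    "('k::field, 'a, 'm) module_scheme \<Rightarrow> 'k \<Rightarrow> (nat \<Rightarrow> nat \<Rightarrow> 'a) \<Rightarrow> nat set \<Rightarrow> 'a"
  where "quantum_minor A q X I =
    (\<Oplus>\<^bsub>A\<^esub>\<sigma>\<in>{\<sigma>. \<sigma> permutes {1..card I}}.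
       ((- q) powi (- int (inversion_number (card I) \<sigma>))) \<odot>\<^bsub>A\<^esub>
       foldr (\<lambda>a p. X (sorted_list_of_set I ! (\<sigma> a - 1)) a \<otimes>\<^bsub>A\<^esub> p) [1..<card I + 1] \<one>\<^bsub>A\<^esub>)"


section \<open>Surrounding\<close>

definition surround_split :: "nat set \<Rightarrow> nat set \<Rightarrow> nat set \<Rightarrow> nat set \<Rightarrow> bool"
  where "surround_split J I J' J'' \<longleftrightarrow>
    J' \<subseteq> J \<and> J'' \<subseteq> J \<and> J' \<inter> J'' = {} \<and> J - I = J' \<union> J'' \<and>
    (\<forall>j'\<in>J'. \<forall>i\<in>I - J. j' < i) \<and> (\<forall>j''\<in>J''. \<forall>i\<in>I - J. i < j'')"

definition surrounds :: "nat set \<Rightarrow> nat set \<Rightarrow> bool"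
  where "surrounds J I \<longleftrightarrow> card J \<le> card I \<and> (\<exists>J' J''. surround_split J I J' J'')"

definition surround_weight :: "nat set \<Rightarrow> nat set \<Rightarrow> int"
  where "surround_weight J I =
    (THE m. \<exists>J' J''. surround_split J I J' J'' \<and> m = int (card J'') - int (card J'))"

lemma surround_split_unique:
  assumes "finite I" "finite J" "card J \<le> card I"
    and A: "surround_split J I A' A''" and B: "surround_split J I B' B''"
  shows "A' = B' \<and> A'' = B''"
proof (cases "I - J = {}")
  case True
  then have "I = J" using assms by (metis Diff_eq_empty_iff card_seteq)
  then show ?thesis using A B by (simp add: surround_split_def)
next
  case False
  then obtain i where i: "i \<in> I - J" by blast
  have "C' = {j \<in> J - I. j < i} \<and> C'' = {j \<in> J - I. i < j}"
    if "surround_split J I C' C''" for C' C''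
  proof -
    have "J - I = C' \<union> C''" "\<forall>j\<in>C'. j < i" "\<forall>j\<in>C''. i < j"
      using that i unfolding surround_split_def by blast+
    then show ?thesis by (auto dest: less_asym)
  qed
  from this[OF A] this[OF B] show ?thesis by simp
qed

lemma surround_weight_eq:
  assumes "finite I" "finite J" "card J \<le> card I" "surround_split J I J' J''"
  shows "surround_weight J I = int (card J'') - int (card J')"
  unfolding surround_weight_def
proof (rule the_equality)
  fix m assume "\<exists>J' J''. surround_split J I J' J'' \<and> m = int (card J'') - int (card J')"
  then show "m = int (card J'') - int (card J')"
    using surround_split_unique[OF assms(1-3) _ assms(4)] by auto
qed (use assms(4) in blast)

end

theory Submission
  imports Defs "HOL-Combinatorics.Multiset_Permutations"
begin

text \<open>Moving row \<open>s\<close> of a quantum matrix to an adjacent row \<open>t\<close> is a skew derivation of the quantum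
  matrix algebra: a Chevalley generator of the quantized enveloping algebra acting on rows. It
  annihilates the quantum minors whose row set contains both of \<open>s\<close>, \<open>t\<close> (or does not contain \<open>s\<close>), and
  it replaces \<open>s\<close> by \<open>t\<close> in the others. If \<open>s, t \<in> J\<close>, applying it to a \<open>q\<close>-commutation relation
  between \<open>[[I]]\<close> and \<open>[[J]]\<close> therefore yields the one with \<open>s\<close> replaced by \<open>t\<close> in \<open>I\<close>, with the same
  power of \<open>q\<close>. When \<open>J\<close> surrounds \<open>I\<close>, such moves (only the rows in \<open>I \<union> J\<close> matter for adjacency)
  reduce the claim to the case where \<open>J'\<close> lies below all of \<open>I\<close> and \<open>J''\<close> above all of \<open>I\<close>. There
  every single entry \<open>x\<^bsub>jk\<^esub>\<close> with \<open>j \<in> J\<close> and \<open>k \<le> |I|\<close> already \<open>q\<close>-commutes with \<open>[[I]]\<close>: in the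
  extremal column the relations give this monomial by monomial, and skew derivations in the
  column direction, which annihilate \<open>[[I]]\<close>, propagate it to the other columns.\<close>

section \<open>Skew derivations of the free algebra\<close>

definition scale :: "'k::field \<Rightarrow> ('x word \<Rightarrow>\<^sub>0 'k) \<Rightarrow> ('x word \<Rightarrow>\<^sub>0 'k)" (infixr "*\<^sub>s" 75)
  where "c *\<^sub>s f = Poly_Mapping.single 0 c * f"

definition mon :: "'x list \<Rightarrow> ('x word \<Rightarrow>\<^sub>0 'k::field)"
  where "mon w = Poly_Mapping.single (Word w) 1"

lemma scale_single: "c *\<^sub>s Poly_Mapping.single w d = Poly_Mapping.single w (c * d)"
  by (simp add: scale_def mult_single)

lemma mon_Nil [simp]: "mon [] = 1"
  by (simp add: mon_def flip: zero_word_def single_one)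

lemma mon_append: "mon (u @ v) = mon u * mon v"
  by (simp add: mon_def mult_single plus_word_def)

lemma letter_eq_mon: "letter x = mon [x]"
  by (simp add: letter_def mon_def)

lemma mon_Cons: "mon (x # w) = letter x * mon w"
  using mon_append[of "[x]" w] by (simp add: letter_eq_mon)

lemma free_algebra_induct [case_names zero add]:
  fixes f :: "'x word \<Rightarrow>\<^sub>0 'k::field"
  assumes "P 0" and "\<And>c w f. P f \<Longrightarrow> P (c *\<^sub>s mon w + f)"
  shows "P f"
proof (induction f rule: update_induct)
  case const
  then show ?case using assms(1) by simp
next
  case (update f w c)
  have "Poly_Mapping.update w c f = c *\<^sub>s mon (letters w) + f"
    using update.hyps
    by (intro poly_mapping_eqI)
      (auto simp: lookup_update mon_def scale_single lookup_add lookup_single in_keys_iff when_def)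
  then show ?case using assms(2)[OF update.IH] by simp
qed

lemma scale_add_right: "c *\<^sub>s (f + g) = c *\<^sub>s f + c *\<^sub>s g"
  and scale_add_left: "(c + d) *\<^sub>s f = c *\<^sub>s f + d *\<^sub>s f"
  and scale_scale: "c *\<^sub>s d *\<^sub>s f = (c * d) *\<^sub>s f"
  and scale_mult_left: "(c *\<^sub>s f) * g = c *\<^sub>s (f * g)"
  and scale_one [simp]: "1 *\<^sub>s f = f"
  and scale_zero [simp]: "0 *\<^sub>s f = 0" "c *\<^sub>s 0 = 0"
  and scale_uminus: "c *\<^sub>s (- f) = - (c *\<^sub>s f)"
  and scale_uminus_left: "(- c) *\<^sub>s f = - (c *\<^sub>s f)"
  and scale_diff: "c *\<^sub>s (f - g) = c *\<^sub>s f - c *\<^sub>s g"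
  and scale_sum: "c *\<^sub>s sum h A = (\<Sum>a\<in>A. c *\<^sub>s h a)"
  by (simp_all add: scale_def distrib_left distrib_right single_add single_uminus mult.assoc
      mult_single right_diff_distrib sum_distrib_left flip: mult.assoc)

text \<open>Scalars are central because the empty word is neutral on both sides, although words in
  general do not commute.\<close>

lemma mult_scale_right: "f * (c *\<^sub>s g) = c *\<^sub>s (f * g)"
proof -
  have "f * Poly_Mapping.single 0 c = Poly_Mapping.single 0 c * f"
  proof (induction f rule: free_algebra_induct)
    case (add d w f)
    then show ?case
      by (simp add: distrib_left distrib_right mon_def scale_single mult_single mult.commute)
  qed simp
  then show ?thesis
    by (simp add: scale_def flip: mult.assoc)
qed

lemma lookup_scale: "Poly_Mapping.lookup (c *\<^sub>s f) w = c * Poly_Mapping.lookup f w"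
proof (induction f rule: free_algebra_induct)
  case (add d v f)
  then show ?case
    by (simp add: scale_add_right mon_def scale_single lookup_add lookup_single when_def algebra_simps)
qed simp

lemmas scale_simps = scale_add_right scale_add_left scale_scale scale_mult_left scale_uminus
  scale_uminus_left scale_diff mult_scale_right

definition lin :: "('x word \<Rightarrow> ('y word \<Rightarrow>\<^sub>0 'k::field)) \<Rightarrow> ('x word \<Rightarrow>\<^sub>0 'k) \<Rightarrow> ('y word \<Rightarrow>\<^sub>0 'k)"
  where "lin \<phi> f = (\<Sum>w\<in>Poly_Mapping.keys f. Poly_Mapping.lookup f w *\<^sub>s \<phi> w)"

lemma lin_superset:
  assumes "finite A" "Poly_Mapping.keys f \<subseteq> A"
  shows "lin \<phi> f = (\<Sum>w\<in>A. Poly_Mapping.lookup f w *\<^sub>s \<phi> w)"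
  unfolding lin_def using assms by (intro sum.mono_neutral_left) (auto simp: in_keys_iff)

lemma lin_zero [simp]: "lin \<phi> 0 = 0"
  by (simp add: lin_def)

lemma lin_add: "lin \<phi> (f + g) = lin \<phi> f + lin \<phi> g"
proof -
  let ?A = "Poly_Mapping.keys f \<union> Poly_Mapping.keys g"
  have "lin \<phi> h = (\<Sum>w\<in>?A. Poly_Mapping.lookup h w *\<^sub>s \<phi> w)" if "h \<in> {f, g, f + g}" for h
    using that Poly_Mapping.keys_add[of f g] by (intro lin_superset) auto
  then show ?thesis
    by (simp add: lookup_add scale_add_left sum.distrib)
qed

lemma lin_scale_mon: "lin \<phi> (c *\<^sub>s mon w) = c *\<^sub>s \<phi> (Word w)"
  by (subst lin_superset[of "{Word w}"]) (auto simp: mon_def scale_single split: if_splits)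

lemma lin_scale: "lin \<phi> (c *\<^sub>s f) = c *\<^sub>s lin \<phi> f"
  by (induction f rule: free_algebra_induct)
    (simp_all add: scale_add_right scale_scale lin_add lin_scale_mon)

lemma lin_mon: "lin \<phi> (mon w) = \<phi> (Word w)"
  using lin_scale_mon[of \<phi> 1] by simp

lemma lin_uminus: "lin \<phi> (- f) = - lin \<phi> f"
  using lin_scale[of \<phi> "-1" f] by (simp add: scale_uminus_left)

lemma lin_diff: "lin \<phi> (f - g) = lin \<phi> f - lin \<phi> g"
  using lin_add[of \<phi> f "- g"] by (simp add: lin_uminus)

lemma lin_sum: "lin \<phi> (sum h A) = (\<Sum>a\<in>A. lin \<phi> (h a))"
  by (induction A rule: infinite_finite_induct) (simp_all add: lin_add)

lemmas lin_simps = lin_add lin_scale lin_mon lin_uminus lin_diff lin_sum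

section \<open>Substitution homomorphisms and skew derivations\<close>

definition subst :: "('x \<Rightarrow> ('y word \<Rightarrow>\<^sub>0 'k::field)) \<Rightarrow> ('x word \<Rightarrow>\<^sub>0 'k) \<Rightarrow> ('y word \<Rightarrow>\<^sub>0 'k)"
  where "subst h = lin (\<lambda>w. prod_list (map h (letters w)))"

lemmas subst_linear = lin_simps[of "\<lambda>w. prod_list (map h (letters w))" for h, folded subst_def, simplified]

lemma subst_zero [simp]: "subst h 0 = 0"
  by (simp add: subst_def)

lemma subst_letter [simp]: "subst h (letter x) = h x"
  by (simp add: letter_eq_mon subst_linear)

lemma subst_mult: "subst h (f * g) = subst h f * subst h g"
proof (induction f rule: free_algebra_induct)
  case (add c u f)
  have "subst h (mon u * g) = subst h (mon u) * subst h g"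
    by (induction g rule: free_algebra_induct)
      (simp_all add: distrib_left subst_linear mult_scale_right flip: mon_append)
  with add show ?case
    by (simp add: distrib_right subst_linear scale_mult_left)
qed simp

text \<open>The rule D(f g) = D(f) h(g) + f D(g), with \<open>h\<close> extended multiplicatively:
  letters to the right of the one hit by \<open>\<delta>\<close> are twisted by \<open>h\<close>,
  letters to its left stay as they are.\<close>

fun skew_word :: "('x \<Rightarrow> ('x word \<Rightarrow>\<^sub>0 'k::field)) \<Rightarrow> ('x \<Rightarrow> ('x word \<Rightarrow>\<^sub>0 'k)) \<Rightarrow> 'x list \<Rightarrow> ('x word \<Rightarrow>\<^sub>0 'k)"
  where
    "skew_word h \<delta> [] = 0"
  | "skew_word h \<delta> (x # w) = \<delta> x * prod_list (map h w) + letter x * skew_word h \<delta> w"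

definition skew :: "('x \<Rightarrow> ('x word \<Rightarrow>\<^sub>0 'k::field)) \<Rightarrow> ('x \<Rightarrow> ('x word \<Rightarrow>\<^sub>0 'k)) \<Rightarrow> ('x word \<Rightarrow>\<^sub>0 'k) \<Rightarrow> ('x word \<Rightarrow>\<^sub>0 'k)"
  where "skew h \<delta> = lin (\<lambda>w. skew_word h \<delta> (letters w))"

lemmas skew_linear = lin_simps[of "\<lambda>w. skew_word h \<delta> (letters w)" for h \<delta>, folded skew_def, simplified]

lemma skew_zero [simp]: "skew h \<delta> 0 = 0"
  by (simp add: skew_def)

lemma skew_one [simp]: "skew h \<delta> 1 = 0"
  using skew_linear(3)[of h \<delta> "[]"] by simp

lemma skew_letter [simp]: "skew h \<delta> (letter x) = \<delta> x"
  by (simp add: letter_eq_mon skew_linear)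

lemma skew_word_append:
  "skew_word h \<delta> (u @ v) = skew_word h \<delta> u * prod_list (map h v) + mon u * skew_word h \<delta> v"
  by (induction u) (simp_all add: mon_Cons algebra_simps)

lemma skew_mult: "skew h \<delta> (f * g) = skew h \<delta> f * subst h g + f * skew h \<delta> g"
proof (induction f rule: free_algebra_induct)
  case (add c u f)
  have "skew h \<delta> (mon u * g) = skew h \<delta> (mon u) * subst h g + mon u * skew h \<delta> g"
    by (induction g rule: free_algebra_induct)
      (simp_all add: distrib_left skew_linear subst_linear mult_scale_right skew_word_append
        scale_add_right flip: mon_append)
  with add show ?case
    by (simp add: distrib_right skew_linear scale_simps)
qed simp

section \<open>Two-sided ideals and their stability under skew derivations\<close>

interpretation free_alg: vector_space scale
  by standard (simp_all add: scale_simps)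

text \<open>The two-sided ideal generated by \<open>G\<close>, built one term
  \<open>a * g * b\<close> at a time so that induction treats a single generator. The factors
  \<open>a\<close> and \<open>b\<close> range over the free algebra on all letters of the
  type.\<close>

inductive_set ideal_gen :: "('x word \<Rightarrow>\<^sub>0 'k::field) set \<Rightarrow> ('x word \<Rightarrow>\<^sub>0 'k) set"
  for G where
    zero: "0 \<in> ideal_gen G"
  | step: "g \<in> G \<Longrightarrow> h \<in> ideal_gen G \<Longrightarrow> a * g * b + h \<in> ideal_gen G"

lemma ideal_gen_add:
  assumes "f \<in> ideal_gen G" "g \<in> ideal_gen G"
  shows "f + g \<in> ideal_gen G"
  using assms(1) by induction (simp_all add: assms(2) add.assoc ideal_gen.step)

lemma ideal_gen_mult_left: "f \<in> ideal_gen G \<Longrightarrow> a * f \<in> ideal_gen G"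
proof (induction rule: ideal_gen.induct)
  case (step g h c b)
  then show ?case using ideal_gen.step[of g G "a * h" "a * c" b] by (simp add: distrib_left mult.assoc)
qed (simp add: ideal_gen.zero)

lemma ideal_gen_mult_right: "f \<in> ideal_gen G \<Longrightarrow> f * a \<in> ideal_gen G"
proof (induction rule: ideal_gen.induct)
  case (step g h c b)
  then show ?case using ideal_gen.step[of g G "h * a" c "b * a"] by (simp add: distrib_right mult.assoc)
qed (simp add: ideal_gen.zero)

lemma ideal_gen_superset: "g \<in> G \<Longrightarrow> g \<in> ideal_gen G"
  using ideal_gen.step[of g G 0 1 1] by (simp add: ideal_gen.zero)

lemma subspace_ideal_gen: "free_alg.subspace (ideal_gen G)"
  by (simp add: free_alg.subspace_def scale_def ideal_gen.zero ideal_gen_add ideal_gen_mult_left)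

lemmas ideal_gen_scale = free_alg.subspace_scale[OF subspace_ideal_gen]
  and ideal_gen_diff = free_alg.subspace_diff[OF subspace_ideal_gen]
  and ideal_gen_sum = free_alg.subspace_sum[OF subspace_ideal_gen]

lemma ideal_gen_mono: "G \<subseteq> H \<Longrightarrow> ideal_gen G \<subseteq> ideal_gen H"
proof
  fix f assume "G \<subseteq> H" "f \<in> ideal_gen G"
  from this(2) show "f \<in> ideal_gen H"
    by induction (use \<open>G \<subseteq> H\<close> in \<open>blast intro: ideal_gen.intros\<close>)+
qed

text \<open>D(a g b) = D(a) h(g) h(b) + a D(g) h(b) + a g D(b), so it is enough that both h(g) and
  D(g) lie in the ideal for each generator g.\<close>

lemma skew_ideal_gen:
  assumes "\<And>g. g \<in> G \<Longrightarrow> subst h g \<in> ideal_gen G" "\<And>g. g \<in> G \<Longrightarrow> skew h \<delta> g \<in> ideal_gen G"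
    and "f \<in> ideal_gen G"
  shows "skew h \<delta> f \<in> ideal_gen G"
  using assms(3)
proof induction
  case (step g f a b)
  then show ?case
    by (simp add: skew_linear skew_mult subst_mult assms(1,2) ideal_gen_superset
        ideal_gen_add ideal_gen_mult_left ideal_gen_mult_right)
qed (simp add: ideal_gen.zero)


section \<open>Quantum matrices\<close>

definition comm_rel :: "'k::field \<Rightarrow> 'x \<Rightarrow> 'x \<Rightarrow> ('x word \<Rightarrow>\<^sub>0 'k)"
  where "comm_rel c x y = letter x * letter y - c *\<^sub>s (letter y * letter x)"

text \<open>The four letters form a 2 x 2 block with rows a b and c d.\<close>

definition cross_rel :: "'k::field \<Rightarrow> 'x \<Rightarrow> 'x \<Rightarrow> 'x \<Rightarrow> 'x \<Rightarrow> ('x word \<Rightarrow>\<^sub>0 'k)"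
  where "cross_rel q a b c d =
    letter d * letter a - (letter a * letter d + (q - inverse q) *\<^sub>s (letter b * letter c))"

text \<open>\<open>P\<close> is an arbitrary set so that it can be the preimage of an ideal under a
  linear map: one predicate then also says that the map sends every relation into the ideal.
  Arbitrary index sets \<open>R\<close> and \<open>C\<close> let adjacency of rows be taken relative
  to the rows that occur.\<close>

definition quantum_matrix ::
    "('x word \<Rightarrow>\<^sub>0 'k::field) set \<Rightarrow> 'k \<Rightarrow> nat set \<Rightarrow> nat set \<Rightarrow> (nat \<Rightarrow> nat \<Rightarrow> 'x) \<Rightarrow> bool"
  where "quantum_matrix P q R C x \<longleftrightarrow>
    (\<forall>i\<in>R. \<forall>k\<in>C. \<forall>l\<in>C. k < l \<longrightarrow> comm_rel q (x i l) (x i k) \<in> P) \<and>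
    (\<forall>i\<in>R. \<forall>j\<in>R. \<forall>k\<in>C. i < j \<longrightarrow> comm_rel q (x j k) (x i k) \<in> P) \<and>
    (\<forall>i\<in>R. \<forall>j\<in>R. \<forall>k\<in>C. \<forall>l\<in>C. i < j \<longrightarrow> k < l \<longrightarrow> comm_rel 1 (x j k) (x i l) \<in> P) \<and>
    (\<forall>i\<in>R. \<forall>j\<in>R. \<forall>k\<in>C. \<forall>l\<in>C. i < j \<longrightarrow> k < l \<longrightarrow>
      cross_rel q (x i k) (x i l) (x j k) (x j l) \<in> P)"

lemma quantum_matrixD:
  assumes "quantum_matrix P q R C x" "i \<in> R" "k \<in> C"
  shows "l \<in> C \<Longrightarrow> k < l \<Longrightarrow> comm_rel q (x i l) (x i k) \<in> P"
    and "j \<in> R \<Longrightarrow> i < j \<Longrightarrow> comm_rel q (x j k) (x i k) \<in> P"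
    and "j \<in> R \<Longrightarrow> l \<in> C \<Longrightarrow> i < j \<Longrightarrow> k < l \<Longrightarrow> comm_rel 1 (x j k) (x i l) \<in> P"
    and "j \<in> R \<Longrightarrow> l \<in> C \<Longrightarrow> i < j \<Longrightarrow> k < l \<Longrightarrow> cross_rel q (x i k) (x i l) (x j k) (x j l) \<in> P"
  using assms by (simp_all add: quantum_matrix_def)

text \<open>Transposition exchanges (1) and (2), changes the sign of (3), and changes (4) by a
  multiple of (3), because the two off-diagonal letters of the block commute.\<close>

lemma quantum_matrix_transpose:
  assumes P: "free_alg.subspace P" and x: "quantum_matrix P q R C x"
  shows "quantum_matrix P q C R (\<lambda>i k. x k i)"
proof -
  note D = quantum_matrixD[OF x]
  have "comm_rel 1 (x i l) (x j k) \<in> P"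
    if "i \<in> R" "j \<in> R" "k \<in> C" "l \<in> C" "i < j" "k < l" for i j k l
  proof -
    have "comm_rel 1 (x i l) (x j k) = - comm_rel 1 (x j k) (x i l)"
      by (simp add: comm_rel_def)
    then show ?thesis
      using free_alg.subspace_neg[OF P D(3)[of i k j l]] that by metis
  qed
  moreover have "cross_rel q (x i k) (x j k) (x i l) (x j l) \<in> P"
    if "i \<in> R" "j \<in> R" "k \<in> C" "l \<in> C" "i < j" "k < l" for i j k l
  proof -
    have "cross_rel q (x i k) (x j k) (x i l) (x j l)
      = cross_rel q (x i k) (x i l) (x j k) (x j l) - (q - inverse q) *\<^sub>s comm_rel 1 (x j k) (x i l)"
      by (simp add: comm_rel_def cross_rel_def scale_simps)
    then show ?thesis
      using D(3,4)[of i k j l] that by (simp add: free_alg.subspace_diff[OF P] free_alg.subspace_scale[OF P])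
  qed
  ultimately show ?thesis
    using D(1,2) by (simp add: quantum_matrix_def)
qed

section \<open>Skew derivations applied to the relations\<close>

lemma subspace_subst: "free_alg.subspace P \<Longrightarrow> free_alg.subspace {f. subst h f \<in> P}"
  and subspace_skew: "free_alg.subspace P \<Longrightarrow> free_alg.subspace {f. skew h \<delta> f \<in> P}"
  by (auto simp: free_alg.subspace_def subst_linear skew_linear)

definition twist :: "('x \<Rightarrow> 'k::field) \<Rightarrow> 'x \<Rightarrow> ('x word \<Rightarrow>\<^sub>0 'k)"
  where "twist t x = t x *\<^sub>s letter x"

lemma skew_comm_rel:
  "skew (twist t) \<delta> (comm_rel c x y) = t y *\<^sub>s (\<delta> x * letter y) + letter x * \<delta> y
    - c *\<^sub>s (t x *\<^sub>s (\<delta> y * letter x) + letter y * \<delta> x)"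
  by (simp add: comm_rel_def skew_linear skew_mult twist_def scale_simps)

lemma skew_cross_rel:
  "skew (twist t) \<delta> (cross_rel q a b c d) = t a *\<^sub>s (\<delta> d * letter a) + letter d * \<delta> a
    - (t d *\<^sub>s (\<delta> a * letter d) + letter a * \<delta> d
      + (q - inverse q) *\<^sub>s (t c *\<^sub>s (\<delta> b * letter c) + letter b * \<delta> c))"
  by (simp add: cross_rel_def skew_linear skew_mult twist_def scale_simps)

lemma subst_twist_comm_rel: "subst (twist t) (comm_rel c x y) = (t x * t y) *\<^sub>s comm_rel c x y"
  by (simp add: comm_rel_def subst_linear subst_mult twist_def scale_simps mult.commute)

lemma subst_twist_cross_rel:
  "t a * t d = t b * t c \<Longrightarrow> subst (twist t) (cross_rel q a b c d) = (t a * t d) *\<^sub>s cross_rel q a b c d"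
  by (simp add: cross_rel_def subst_linear subst_mult twist_def scale_simps mult.commute)

text \<open>Both surviving terms are multiples of the square of one letter, and the twist makes
  their coefficients agree.\<close>

lemma skew_pair:
  assumes "q \<noteq> 0" "t a = q" "t c = inverse q"
  shows "\<delta> a = letter c \<Longrightarrow> \<delta> c = 0 \<Longrightarrow> skew (twist t) \<delta> (comm_rel q c a) = 0"
    and "\<delta> c = letter a \<Longrightarrow> \<delta> a = 0 \<Longrightarrow> skew (twist t) \<delta> (comm_rel q c a) = 0"
  by (simp_all add: skew_comm_rel assms scale_simps)

lemmas rel_lookup_simps = poly_mapping_eq_iff fun_eq_iff lookup_add lookup_minus lookup_scale
  scale_mult_left mult_scale_right

text \<open>The upper row of a block is moved onto the lower one. The right-hand sides come from
  expanding the product rule; as identities of the free algebra they can be checked coefficient by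
  coefficient. \<open>skew_block_up\<close> treats the opposite direction.\<close>

lemma skew_block_down:
  assumes "q \<noteq> 0" "t a = q" "t b = q" "t c = inverse q" "t d = inverse q"
    and "\<delta> a = letter c" "\<delta> b = letter d" "\<delta> c = 0" "\<delta> d = 0"
  shows "skew (twist t) \<delta> (comm_rel q b a) = q *\<^sub>s cross_rel q a b c d - (q * q) *\<^sub>s comm_rel 1 c b"
    and "skew (twist t) \<delta> (comm_rel q d c) = 0"
    and "skew (twist t) \<delta> (comm_rel 1 c b) = (- inverse q) *\<^sub>s comm_rel q d c"
    and "skew (twist t) \<delta> (cross_rel q a b c d) = (inverse q * inverse q) *\<^sub>s comm_rel q d c"
  unfolding skew_comm_rel skew_cross_rel
  by (simp_all add: assms comm_rel_def cross_rel_def rel_lookup_simps field_simps)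

lemma skew_block_up:
  assumes "q \<noteq> 0" "t a = q" "t b = q" "t c = inverse q" "t d = inverse q"
    and "\<delta> a = 0" "\<delta> b = 0" "\<delta> c = letter a" "\<delta> d = letter b"
  shows "skew (twist t) \<delta> (comm_rel q b a) = 0"
    and "skew (twist t) \<delta> (comm_rel q d c) = cross_rel q a b c d - q *\<^sub>s comm_rel 1 c b"
    and "skew (twist t) \<delta> (comm_rel 1 c b) = (- 1) *\<^sub>s comm_rel q b a"
    and "skew (twist t) \<delta> (cross_rel q a b c d) = inverse q *\<^sub>s comm_rel q b a"
  unfolding skew_comm_rel skew_cross_rel
  by (simp_all add: assms comm_rel_def cross_rel_def rel_lookup_simps field_simps)

definition between :: "nat \<Rightarrow> nat \<Rightarrow> nat set"
  where "between s t = {min s t<..<max s t}"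

text \<open>The action of the group-like generator that accompanies the Chevalley generators of an
  adjacent pair of rows. It is symmetric in \<open>s\<close> and \<open>t\<close>, so moves in both
  directions share one twist.\<close>

definition shift_twist :: "'k::field \<Rightarrow> nat \<Rightarrow> nat \<Rightarrow> nat \<Rightarrow> 'k"
  where "shift_twist q s t i = (if i = min s t then q else if i = max s t then inverse q else 1)"

lemma shift_twist_simps:
  "s < t \<Longrightarrow> shift_twist q s t s = q" "s < t \<Longrightarrow> shift_twist q s t t = inverse q"
  "t < s \<Longrightarrow> shift_twist q s t s = inverse q" "t < s \<Longrightarrow> shift_twist q s t t = q"
  "i \<noteq> s \<Longrightarrow> i \<noteq> t \<Longrightarrow> shift_twist q s t i = 1"
  by (auto simp: shift_twist_def)

lemma not_between:
  "i \<notin> between s t \<Longrightarrow> i \<noteq> s \<Longrightarrow> i \<noteq> t \<Longrightarrow> s \<noteq> t \<Longrightarrow> (i < s \<longleftrightarrow> i < t) \<and> (s < i \<longleftrightarrow> t < i)"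
  by (auto simp: between_def min_def max_def split: if_splits)

text \<open>Relations without row \<open>s\<close> are killed. A relation between \<open>s\<close>
  and a third row becomes the same relation for \<open>t\<close>, since by adjacency the third row
  lies on the same side of both. What remains lives in a block with rows \<open>s\<close> and
  \<open>t\<close>, where the block identities and \<open>skew_pair\<close> apply.\<close>

lemma quantum_matrix_skew:
  assumes P: "free_alg.subspace P" and x: "quantum_matrix P q R C x" and q: "q \<noteq> 0"
    and st: "s \<in> R" "t \<in> R" "s \<noteq> t" "R \<inter> between s t = {}"
    and tw: "\<And>i k. tw (x i k) = shift_twist q s t i"
    and \<delta>: "\<And>i k. \<delta> (x i k) = (if i = s then letter (x t k) else 0)"
  shows "quantum_matrix {f. skew (twist tw) \<delta> f \<in> P} q R C x"
proof -
  let ?D = "skew (twist tw) \<delta>"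
  note D = quantum_matrixD[OF x]
  note closed = free_alg.subspace_0[OF P] free_alg.subspace_neg[OF P] free_alg.subspace_diff[OF P] free_alg.subspace_scale[OF P]
  have nb: "(i < s \<longleftrightarrow> i < t) \<and> (s < i \<longleftrightarrow> t < i)" if "i \<in> R" "i \<noteq> s" "i \<noteq> t" for i
    using not_between[of i s t] that st by blast
  have 1: "?D (comm_rel q (x i l) (x i k)) \<in> P" if "i \<in> R" "k \<in> C" "l \<in> C" "k < l" for i k l
  proof (cases "i = s")
    case [simp]: True
    show ?thesis
    proof (cases "s < t")
      case True
      show ?thesis
        using skew_block_down(1)[of q tw "x s k" "x s l" "x t k" "x t l" \<delta>] True q st that
        by (simp add: tw \<delta> shift_twist_simps closed D)
    next
      case False
      show ?thesis
        using skew_block_up(2)[of q tw "x t k" "x t l" "x s k" "x s l" \<delta>] False q st that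
        by (simp add: tw \<delta> shift_twist_simps closed D)
    qed
  qed (simp add: skew_comm_rel \<delta> closed)
  have 2: "?D (comm_rel q (x j k) (x i k)) \<in> P" if ij: "i \<in> R" "j \<in> R" "k \<in> C" "i < j" for i j k
  proof -
    consider "i = s" "j = t" | "i = t" "j = s" | "i = s" "j \<noteq> t" | "j = s" "i \<noteq> t" | "i \<noteq> s" "j \<noteq> s"
      by blast
    then show ?thesis
    proof cases
      case 3
      with ij nb[of j] st have "t < j" by auto
      with D(2)[of t k j] 3 ij st show ?thesis
        by (simp add: skew_comm_rel \<delta> tw shift_twist_simps) (simp add: comm_rel_def)
    next
      case 4
      with ij nb[of i] st have "i < t" by auto
      with D(2)[of i k t] 4 ij st show ?thesis
        by (simp add: skew_comm_rel \<delta> tw shift_twist_simps) (simp add: comm_rel_def)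
    qed (use q ij in \<open>auto simp: skew_pair tw \<delta> shift_twist_simps closed skew_comm_rel\<close>)
  qed
  have 3: "?D (comm_rel 1 (x j k) (x i l)) \<in> P \<and> ?D (cross_rel q (x i k) (x i l) (x j k) (x j l)) \<in> P"
    if ij: "i \<in> R" "j \<in> R" "k \<in> C" "l \<in> C" "i < j" "k < l" for i j k l
  proof -
    consider "i = s" "j = t" | "i = t" "j = s" | "i = s" "j \<noteq> t" | "j = s" "i \<noteq> t" | "i \<noteq> s" "j \<noteq> s"
      by blast
    then show ?thesis
    proof cases
      case 1
      with ij q st show ?thesis
        using skew_block_down(3,4)[of q tw "x i k" "x i l" "x j k" "x j l" \<delta>]
        by (simp add: tw \<delta> shift_twist_simps closed D)
    next
      case 2
      with ij q st show ?thesis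
        using skew_block_up(3,4)[of q tw "x i k" "x i l" "x j k" "x j l" \<delta>]
        by (simp add: tw \<delta> shift_twist_simps closed D)
    next
      case 3
      with ij nb[of j] st have "t < j" by auto
      with D(3,4)[of t k j l] 3 ij st show ?thesis
        by (simp add: skew_comm_rel skew_cross_rel \<delta> tw shift_twist_simps)
          (simp add: comm_rel_def cross_rel_def)
    next
      case 4
      with ij nb[of i] st have "i < t" by auto
      with D(3,4)[of i k t l] 4 ij st show ?thesis
        by (simp add: skew_comm_rel skew_cross_rel \<delta> tw shift_twist_simps)
          (simp add: comm_rel_def cross_rel_def)
    qed (simp add: skew_comm_rel skew_cross_rel \<delta> closed)
  qed
  show ?thesis
    using 1 2 3 by (simp add: quantum_matrix_def)
qed

lemma quantum_matrix_twist:
  assumes P: "free_alg.subspace P" and x: "quantum_matrix P q R C x"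
    and tw: "\<And>i k. tw (x i k) = \<tau> i"
  shows "quantum_matrix {f. subst (twist tw) f \<in> P} q R C x"
  using quantum_matrixD[OF x]
  by (auto simp: quantum_matrix_def subst_twist_comm_rel subst_twist_cross_rel tw
      intro!: free_alg.subspace_scale[OF P])

section \<open>The ideal of relations and its stability under row and column moves\<close>

definition matrix_rels :: "'k::field \<Rightarrow> nat set \<Rightarrow> nat set \<Rightarrow> ((nat \<times> nat) word \<Rightarrow>\<^sub>0 'k) set"
  where "matrix_rels q R C =
    {comm_rel q (i, l) (i, k) | i k l. i \<in> R \<and> k \<in> C \<and> l \<in> C \<and> k < l} \<union>
    {comm_rel q (j, k) (i, k) | i j k. i \<in> R \<and> j \<in> R \<and> k \<in> C \<and> i < j} \<union>
    {comm_rel 1 (j, k) (i, l) | i j k l. i \<in> R \<and> j \<in> R \<and> k \<in> C \<and> l \<in> C \<and> i < j \<and> k < l} \<union>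
    {cross_rel q (i, k) (i, l) (j, k) (j, l) | i j k l.
      i \<in> R \<and> j \<in> R \<and> k \<in> C \<and> l \<in> C \<and> i < j \<and> k < l}"

lemma quantum_matrix_iff: "quantum_matrix P q R C Pair \<longleftrightarrow> matrix_rels q R C \<subseteq> P"
  unfolding quantum_matrix_def matrix_rels_def Un_subset_iff conj_assoc by (intro conj_cong; blast)

abbreviation matrix_ideal :: "'k::field \<Rightarrow> nat set \<Rightarrow> nat set \<Rightarrow> ((nat \<times> nat) word \<Rightarrow>\<^sub>0 'k) set"
  where "matrix_ideal q R C \<equiv> ideal_gen (matrix_rels q R C)"

lemma quantum_matrix_ideal: "quantum_matrix (matrix_ideal q R C) q R C Pair"
  unfolding quantum_matrix_iff by (blast intro: ideal_gen_superset)

definition row_twist :: "'k::field \<Rightarrow> nat \<Rightarrow> nat \<Rightarrow> nat \<times> nat \<Rightarrow> ((nat \<times> nat) word \<Rightarrow>\<^sub>0 'k)"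
  where "row_twist q s t = twist (\<lambda>(i, k). shift_twist q s t i)"

definition row_move :: "'k::field \<Rightarrow> nat \<Rightarrow> nat \<Rightarrow> ((nat \<times> nat) word \<Rightarrow>\<^sub>0 'k) \<Rightarrow> ((nat \<times> nat) word \<Rightarrow>\<^sub>0 'k)"
  where "row_move q s t = skew (row_twist q s t) (\<lambda>(i, k). if i = s then letter (t, k) else 0)"

definition col_twist :: "'k::field \<Rightarrow> nat \<Rightarrow> nat \<Rightarrow> nat \<times> nat \<Rightarrow> ((nat \<times> nat) word \<Rightarrow>\<^sub>0 'k)"
  where "col_twist q s t = twist (\<lambda>(i, k). shift_twist q s t k)"

definition col_move :: "'k::field \<Rightarrow> nat \<Rightarrow> nat \<Rightarrow> ((nat \<times> nat) word \<Rightarrow>\<^sub>0 'k) \<Rightarrow> ((nat \<times> nat) word \<Rightarrow>\<^sub>0 'k)"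
  where "col_move q s t = skew (col_twist q s t) (\<lambda>(i, k). if k = s then letter (i, t) else 0)"

lemma row_move_ideal:
  assumes "q \<noteq> 0" "s \<in> R" "t \<in> R" "s \<noteq> t" "R \<inter> between s t = {}" "f \<in> matrix_ideal q R C"
  shows "row_move q s t f \<in> matrix_ideal q R C"
proof -
  let ?N = "matrix_ideal q R C"
  note P = subspace_ideal_gen[of "matrix_rels q R C"] and x = quantum_matrix_ideal[of q R C]
  have "matrix_rels q R C \<subseteq> {f. subst (row_twist q s t) f \<in> ?N}"
    unfolding quantum_matrix_iff[symmetric] row_twist_def
    by (rule quantum_matrix_twist[OF P x]) simp
  moreover have "matrix_rels q R C \<subseteq> {f. row_move q s t f \<in> ?N}"
    unfolding quantum_matrix_iff[symmetric] row_move_def row_twist_def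
    by (rule quantum_matrix_skew[OF P x assms(1-5)]) simp_all
  ultimately show ?thesis
    unfolding row_move_def by (intro skew_ideal_gen[OF _ _ assms(6)]) (auto simp: row_move_def)
qed

text \<open>Reduces to rows by transposing twice: first the matrix, then inside the preimage of the
  ideal under the twist or the move, which is again a subspace.\<close>

lemma col_move_ideal:
  assumes "q \<noteq> 0" "s \<in> C" "t \<in> C" "s \<noteq> t" "C \<inter> between s t = {}" "f \<in> matrix_ideal q R C"
  shows "col_move q s t f \<in> matrix_ideal q R C"
proof -
  let ?N = "matrix_ideal q R C"
  note P = subspace_ideal_gen[of "matrix_rels q R C"]
  note x = quantum_matrix_transpose[OF P quantum_matrix_ideal[of q R C]]
  have "matrix_rels q R C \<subseteq> {f. subst (col_twist q s t) f \<in> ?N}"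
    unfolding quantum_matrix_iff[symmetric] col_twist_def
    by (rule quantum_matrix_transpose[OF subspace_subst[OF P] quantum_matrix_twist[OF P x]]) simp
  moreover have "matrix_rels q R C \<subseteq> {f. col_move q s t f \<in> ?N}"
    unfolding quantum_matrix_iff[symmetric] col_move_def col_twist_def
    by (rule quantum_matrix_transpose[OF subspace_skew[OF P] quantum_matrix_skew[OF P x assms(1-5)]])
      simp_all
  ultimately show ?thesis
    unfolding col_move_def by (intro skew_ideal_gen[OF _ _ assms(6)]) (auto simp: col_move_def)
qed

section \<open>Quantum minors in the free algebra\<close>

fun inversions :: "nat list \<Rightarrow> nat" where
  "inversions [] = 0"
| "inversions (x # xs) = length (filter (\<lambda>y. y < x) xs) + inversions xs"

lemma inversions_append:
  "inversions (u @ v) = inversions u + inversions v + (\<Sum>x\<leftarrow>u. length (filter (\<lambda>y. y < x) v))"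
  by (induction u) simp_all

lemma inversions_map:
  assumes "\<And>x y. x \<in> set r \<Longrightarrow> y \<in> set r \<Longrightarrow> f x < f y \<longleftrightarrow> x < y"
  shows "inversions (map f r) = inversions r"
  using assms
proof (induction r)
  case (Cons x r)
  have "filter (\<lambda>y. f y < f x) r = filter (\<lambda>y. y < x) r"
    using Cons.prems by (intro filter_cong) auto
  with Cons show ?case
    by (simp add: filter_map comp_def)
qed simp

lemma inversions_swap_entries:
  assumes "x < y"
  shows "inversions (u @ y # x # v) = Suc (inversions (u @ x # y # v))"
proof -
  have "(\<Sum>z\<leftarrow>u. length (filter (\<lambda>w. w < z) (y # x # v))) = (\<Sum>z\<leftarrow>u. length (filter (\<lambda>w. w < z) (x # y # v)))"
    by (intro arg_cong[of _ _ sum_list] map_cong) auto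
  with assms show ?thesis
    unfolding inversions_append by simp
qed

text \<open>Every other entry compares in the same way with \<open>s\<close> as with
  \<open>t\<close>, so only the exchanged pair itself changes the count.\<close>

lemma inversions_swap_values:
  assumes "s < t" "\<And>z. z \<in> set u \<union> set v \<union> set w \<Longrightarrow> (z < s \<longleftrightarrow> z < t) \<and> (s < z \<longleftrightarrow> t < z)"
  shows "inversions (u @ t # v @ s # w) = Suc (inversions (u @ s # v @ t # w))"
proof -
  have f: "filter (\<lambda>y. y < t) v = filter (\<lambda>y. y < s) v" "filter (\<lambda>y. y < t) w = filter (\<lambda>y. y < s) w"
    using assms(2) by (auto intro!: filter_cong)
  have v: "(\<Sum>x\<leftarrow>v. length (filter (\<lambda>y. y < x) (s # w))) = (\<Sum>x\<leftarrow>v. length (filter (\<lambda>y. y < x) (t # w)))"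
    using assms(2) by (intro arg_cong[of _ _ sum_list] map_cong) auto
  have u: "(\<Sum>x\<leftarrow>u. length (filter (\<lambda>y. y < x) (t # v @ s # w)))
      = (\<Sum>x\<leftarrow>u. length (filter (\<lambda>y. y < x) (s # v @ t # w)))"
    by (intro arg_cong[of _ _ sum_list] map_cong) auto
  show ?thesis
    unfolding inversions_append u inversions.simps v using f assms(1) by simp
qed

section \<open>Minors as elements of the free algebra, and their invariance under twists\<close>

definition row_word :: "nat \<Rightarrow> nat list \<Rightarrow> ((nat \<times> nat) word \<Rightarrow>\<^sub>0 'k::field)"
  where "row_word k r = mon (zip r [k..<k + length r])"

lemma row_word_Nil [simp]: "row_word k [] = 1"
  by (simp add: row_word_def)

lemma row_word_Cons: "row_word k (x # r) = letter (x, k) * row_word (Suc k) r"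
proof -
  have "[k..<k + length (x # r)] = k # [Suc k..<Suc k + length r]"
    by (subst upt_conv_Cons) simp_all
  then show ?thesis
    by (simp add: row_word_def mon_Cons)
qed

lemma row_word_append: "row_word k (u @ v) = row_word k u * row_word (k + length u) v"
  by (induction u arbitrary: k) (simp_all add: row_word_Cons mult.assoc)

text \<open>The sum runs over orderings of the row set instead of permutations of positions, so that
  replacing one row by another acts directly on the lists.\<close>

definition minor :: "'k::field \<Rightarrow> nat set \<Rightarrow> ((nat \<times> nat) word \<Rightarrow>\<^sub>0 'k)"
  where "minor q I = (\<Sum>r\<in>permutations_of_set I. inverse (- q) ^ inversions r *\<^sub>s row_word 1 r)"

lemma prod_list_distinct:
  "distinct r \<Longrightarrow> prod_list (map f r) = (\<Prod>x\<in>set r. f x :: 'a::comm_monoid_mult)"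
  by (induction r) simp_all

text \<open>The factors \<open>q\<close> and \<open>inverse q\<close> cancel or are both absent;
  hence twists fix the minors that contain both of \<open>s\<close>, \<open>t\<close> or
  neither.\<close>

lemma prod_shift_twist:
  assumes "finite A" "q \<noteq> 0" "s \<noteq> t" "s \<in> A \<longleftrightarrow> t \<in> A"
  shows "(\<Prod>i\<in>A. shift_twist q s t i) = 1"
proof (cases "s \<in> A")
  case True
  then have "(\<Prod>i\<in>A. shift_twist q s t i) = (\<Prod>i\<in>{s, t}. shift_twist q s t i)"
    using assms by (intro prod.mono_neutral_right) (auto simp: shift_twist_simps)
  also have "\<dots> = 1"
    using assms by (cases s t rule: linorder_cases) (simp_all add: shift_twist_simps)
  finally show ?thesis .
next
  case False
  with assms show ?thesis by (intro prod.neutral) (metis shift_twist_simps(5))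
qed

lemma subst_row_twist_row_word:
  "subst (row_twist q s t) (row_word k r) = prod_list (map (shift_twist q s t) r) *\<^sub>s row_word k r"
  by (induction r arbitrary: k)
    (simp_all add: row_word_Cons subst_mult row_twist_def twist_def scale_simps subst_linear(3)[of _ "[]", simplified])

lemma subst_col_twist_row_word:
  "subst (col_twist q s t) (row_word k r)
    = prod_list (map (shift_twist q s t) [k..<k + length r]) *\<^sub>s row_word k r"
proof (induction r arbitrary: k)
  case (Cons x r)
  have "[k..<k + length (x # r)] = k # [Suc k..<Suc k + length r]"
    by (subst upt_conv_Cons) simp_all
  with Cons[of "Suc k"] show ?case
    by (simp add: row_word_Cons subst_mult col_twist_def twist_def scale_simps)
qed (simp add: subst_linear(3)[of _ "[]", simplified])

lemma subst_row_twist_minor: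
  assumes "finite I" "q \<noteq> 0" "s \<noteq> t" "s \<in> I \<longleftrightarrow> t \<in> I"
  shows "subst (row_twist q s t) (minor q I) = minor q I"
  unfolding minor_def subst_linear
  by (intro sum.cong refl)
    (simp add: subst_row_twist_row_word prod_list_distinct permutations_of_setD prod_shift_twist[OF assms])

lemma subst_col_twist_minor:
  assumes "q \<noteq> 0" "s \<noteq> t" "s \<in> {1..card I}" "t \<in> {1..card I}"
  shows "subst (col_twist q s t) (minor q I) = minor q I"
proof -
  have "prod_list (map (shift_twist q s t) [1..<1 + card I]) = 1"
    using prod_shift_twist[of "{1..<1 + card I}" q s t] assms
    by (subst prod_list_distinct) (auto simp: mult.commute)
  then show ?thesis
    unfolding minor_def subst_linear
    by (intro sum.cong refl) (simp add: subst_col_twist_row_word length_finite_permutations_of_set)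
qed

section \<open>Row moves applied to minors\<close>

lemma row_move_row_word_0: "s \<notin> set r \<Longrightarrow> row_move q s t (row_word k r) = 0"
  by (induction r arbitrary: k) (auto simp: row_move_def row_word_Cons skew_mult)

lemma subst_row_twist_row_word_id:
  assumes "s \<notin> set r" "t \<notin> set r"
  shows "subst (row_twist q s t) (row_word k r) = row_word k r"
proof -
  have "prod_list (map (shift_twist q s t) r) = 1"
    using assms by (induction r) (auto simp: shift_twist_simps)
  then show ?thesis by (simp add: subst_row_twist_row_word)
qed

lemma row_move_row_word_1:
  assumes "s \<notin> set u" "s \<notin> set v" "t \<notin> set v"
  shows "row_move q s t (row_word k (u @ s # v)) = row_word k (u @ t # v)"
  using row_move_row_word_0[OF assms(1), of q t k] row_move_row_word_0[OF assms(2), of q t]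
    subst_row_twist_row_word_id[OF assms(2,3), of q]
  by (simp add: row_move_def row_word_append row_word_Cons skew_mult)

lemma row_move_row_word_2:
  assumes "s \<noteq> t" "{s, t} \<inter> (set u \<union> set v \<union> set w) = {}"
  shows "row_move q s t (row_word k (u @ s # v @ t # w)) =
      shift_twist q s t t *\<^sub>s row_word k (u @ t # v @ t # w)"
    and "row_move q s t (row_word k (u @ t # v @ s # w)) = row_word k (u @ t # v @ t # w)"
proof -
  have "s \<notin> set u" "s \<notin> set v" "s \<notin> set w" "t \<notin> set u" "t \<notin> set v" "t \<notin> set w"
    using assms by auto
  note r = this
  have "row_move q s t (row_word k u) = 0" "row_move q s t (row_word k v) = 0" "row_move q s t (row_word k w) = 0" for k
    using row_move_row_word_0 r by blast+
  note [simp] = this[unfolded row_move_def]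
  note [simp] = subst_row_twist_row_word_id[OF r(1,4)] subst_row_twist_row_word_id[OF r(2,5)]
    subst_row_twist_row_word_id[OF r(3,6)]
  have [simp]: "row_twist q s t (t, k) = shift_twist q s t t *\<^sub>s letter (t, k)" for k
    by (simp add: row_twist_def twist_def)
  show "row_move q s t (row_word k (u @ s # v @ t # w)) =
      shift_twist q s t t *\<^sub>s row_word k (u @ t # v @ t # w)"
    "row_move q s t (row_word k (u @ t # v @ s # w)) = row_word k (u @ t # v @ t # w)"
    using assms(1)
    by (simp_all add: row_move_def row_word_append row_word_Cons skew_mult subst_mult scale_simps)
qed

lemma split_list_two:
  assumes "distinct r" "s \<in> set r" "t \<in> set r" "s \<noteq> t"
  obtains u v w where "r = u @ s # v @ t # w" | u v w where "r = u @ t # v @ s # w"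
proof -
  obtain a b where r: "r = a @ s # b" "s \<notin> set a" "s \<notin> set b"
    using assms(1,2) by (metis distinct.simps(2) distinct_append in_set_conv_decomp_first split_list)
  show thesis
  proof (cases "t \<in> set a")
    case True
    then obtain c d where "a = c @ t # d" by (meson split_list)
    with r show thesis using that(2)[of c d b] by simp
  next
    case False
    with assms r have "t \<in> set b" by auto
    then obtain c d where "b = c @ t # d" by (meson split_list)
    with r show thesis using that(1)[of a c d] by simp
  qed
qed

text \<open>Reindexing along the bijection turns twice the sum into a sum of pairs; characteristic 0
  permits division by 2.\<close>

lemma sum_cancel_pairs:
  fixes P :: "('x word \<Rightarrow>\<^sub>0 'k::field_char_0) set"
  assumes P: "free_alg.subspace P" and "bij_betw \<phi> A A" and "\<And>r. r \<in> A \<Longrightarrow> F r + F (\<phi> r) \<in> P"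
  shows "sum F A \<in> P"
proof -
  have "sum F A + sum F A = (\<Sum>r\<in>A. F r + F (\<phi> r))"
    using sum.reindex_bij_betw[OF assms(2), of F] by (simp add: sum.distrib)
  also have "\<dots> \<in> P"
    by (rule free_alg.subspace_sum[OF P assms(3)])
  finally have "(1 / 2) *\<^sub>s (sum F A + sum F A) \<in> P"
    by (rule free_alg.subspace_scale[OF P])
  then show ?thesis
    by (simp add: scale_add_right flip: scale_add_left)
qed

lemma row_move_minor_0:
  assumes "s \<notin> I"
  shows "row_move q s t (minor q I) = 0"
  unfolding minor_def row_move_def skew_linear
  using assms by (intro sum.neutral) (simp add: row_move_row_word_0[unfolded row_move_def] permutations_of_setD)

text \<open>Words are paired by exchanging \<open>s\<close> and \<open>t\<close>. The move sends
  both to multiples of the same word with \<open>t\<close> twice; the extra inversion contributes a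
  factor -1/q, which cancels against the twist. The result is 0 already in the free algebra, without
  using relations.\<close>

lemma row_move_minor_both:
  fixes q :: "'k::field_char_0"
  assumes q: "q \<noteq> 0" and "s \<in> J" "t \<in> J" "s \<noteq> t" and nb: "J \<inter> between s t = {}"
  shows "row_move q s t (minor q J) = 0"
proof -
  let ?F = "\<lambda>r. inverse (- q) ^ inversions r *\<^sub>s row_move q s t (row_word 1 r)"
  let ?\<tau> = "Transposition.transpose s t"
  have \<tau>: "?\<tau> permutes J"
    using assms by (simp add: permutes_swap_id)
  have "bij_betw (map ?\<tau>) (permutations_of_set J) (permutations_of_set J)"
    unfolding bij_betw_def
    using permutations_of_set_image_permutes[OF \<tau>] permutes_inj[OF \<tau>] inj_mapI
    by (metis inj_on_subset subset_UNIV)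
  moreover have "?F r + ?F (map ?\<tau> r) \<in> {0}" if "r \<in> permutations_of_set J" for r
  proof -
    have pair: "?F (u @ s # v @ t # w) + ?F (u @ t # v @ s # w) = 0"
      if d: "distinct (u @ s # v @ t # w)" and J: "set (u @ s # v @ t # w) = J" for u v w
    proof -
      have *: "(z < s \<longleftrightarrow> z < t) \<and> (s < z \<longleftrightarrow> t < z)" if "z \<in> set u \<union> set v \<union> set w" for z
        by (rule not_between) (use that d nb J \<open>s \<noteq> t\<close> in auto)
      have **: "{s, t} \<inter> (set u \<union> set v \<union> set w) = {}"
        using d by auto
      show ?thesis
      proof (cases "s < t")
        case True
        then show ?thesis
          using inversions_swap_values[OF True *] row_move_row_word_2[OF \<open>s \<noteq> t\<close> **, of q 1] q
          by (simp add: shift_twist_simps scale_simps)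
      next
        case False
        with \<open>s \<noteq> t\<close> have "t < s" by simp
        moreover have "inversions (u @ s # v @ t # w) = Suc (inversions (u @ t # v @ s # w))"
          using * by (intro inversions_swap_values \<open>t < s\<close>) blast
        ultimately show ?thesis
          using row_move_row_word_2[OF \<open>s \<noteq> t\<close> **, of q 1] q
          by (simp add: shift_twist_simps scale_simps)
      qed
    qed
    have r: "distinct r" "set r = J" using that by (simp_all add: permutations_of_setD)
    have fixed: "map ?\<tau> x = x" if "s \<notin> set x" "t \<notin> set x" for x
      using that by (intro map_idI) (auto simp: Transposition.transpose_def)
    have "s \<in> set r" "t \<in> set r" using r assms by auto
    from split_list_two[OF r(1) this \<open>s \<noteq> t\<close>] show ?thesis
    proof cases
      case (1 u v w)
      with r have "map ?\<tau> r = u @ t # v @ s # w" by (auto simp: fixed)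
      with pair[of u v w] 1 r show ?thesis by simp
    next
      case (2 u v w)
      with r have "map ?\<tau> r = u @ s # v @ t # w" by (auto simp: fixed)
      with pair[of u v w] 2 r show ?thesis by (simp add: add.commute insert_commute)
    qed
  qed
  ultimately have "sum ?F (permutations_of_set J) \<in> {0}"
    by (rule sum_cancel_pairs[OF free_alg.subspace_single_0])
  then show ?thesis
    by (simp add: minor_def row_move_def skew_linear)
qed

text \<open>By adjacency, writing \<open>t\<close> for \<open>s\<close> keeps the relative order of
  the rows and hence the inversions. No twist factor appears because the other letters lie in
  neither row \<open>s\<close> nor row \<open>t\<close>.\<close>

lemma row_move_minor_single:
  assumes "s \<in> I" "t \<notin> I" and nb: "I \<inter> between s t = {}"
  shows "row_move q s t (minor q I) = minor q (insert t (I - {s}))"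
proof -
  let ?f = "\<lambda>x. if x = s then t else x"
  have st: "s \<noteq> t" using assms by blast
  have inj: "inj_on ?f I" using assms by (auto simp: inj_on_def)
  have "?f ` I = insert t (I - {s})" using assms by auto
  then have perm: "permutations_of_set (insert t (I - {s})) = map ?f ` permutations_of_set I"
    using permutations_of_set_image_inj[OF inj] by simp
  have "inj_on (map ?f) (permutations_of_set I)"
    using inj by (intro inj_on_mapI inj_on_subset[OF inj]) (auto dest: permutations_of_setD)
  then have "minor q (insert t (I - {s}))
      = (\<Sum>r\<in>permutations_of_set I. inverse (- q) ^ inversions (map ?f r) *\<^sub>s row_word 1 (map ?f r))"
    unfolding minor_def perm by (simp add: sum.reindex)
  also have "\<dots> = (\<Sum>r\<in>permutations_of_set I. inverse (- q) ^ inversions r *\<^sub>s row_move q s t (row_word 1 r))"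
  proof (intro sum.cong refl)
    fix r assume "r \<in> permutations_of_set I"
    then have r: "distinct r" "set r = I" by (simp_all add: permutations_of_setD)
    then obtain u v where uv: "r = u @ s # v"
      using assms(1) by (metis split_list)
    have "map ?f u = u" "map ?f v = v"
      using uv r by (auto intro!: map_idI)
    moreover have "s \<notin> set u" "s \<notin> set v" "t \<notin> set v"
      using uv r assms by auto
    ultimately have "row_move q s t (row_word 1 r) = row_word 1 (map ?f r)"
      using row_move_row_word_1[of s u v t q 1] uv by simp
    moreover have "inversions (map ?f r) = inversions r"
    proof (rule inversions_map)
      fix x y assume "x \<in> set r" "y \<in> set r"
      then show "?f x < ?f y \<longleftrightarrow> x < y"
        using not_between[of x s t] not_between[of y s t] r assms st by auto
    qed
    ultimately show "inverse (- q) ^ inversions (map ?f r) *\<^sub>s row_word 1 (map ?f r)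
        = inverse (- q) ^ inversions r *\<^sub>s row_move q s t (row_word 1 r)"
      by simp
  qed
  also have "\<dots> = row_move q s t (minor q I)"
    by (simp add: minor_def row_move_def skew_linear)
  finally show ?thesis ..
qed

section \<open>Column moves applied to minors\<close>

lemma col_move_row_word_0: "s \<notin> {k..<k + length r} \<Longrightarrow> col_move q s t (row_word k r) = 0"
  by (induction r arbitrary: k) (auto simp: col_move_def row_word_Cons skew_mult)

lemma subst_col_twist_row_word_id:
  assumes "s \<notin> {k..<k + length r}" "t \<notin> {k..<k + length r}"
  shows "subst (col_twist q s t) (row_word k r) = row_word k r"
proof -
  have "prod_list (map (shift_twist q s t) [k..<k + length r]) = 1"
    using assms by (subst prod_list_distinct) (auto intro!: prod.neutral simp: shift_twist_def min_def max_def)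
  then show ?thesis by (simp add: subst_col_twist_row_word)
qed

text \<open>Both neighbouring letters end up in column \<open>t\<close>. The factor
  \<open>inverse q\<close> occurs when the left letter is moved, since then the right one, in column
  \<open>t\<close>, is twisted.\<close>

lemma col_move_row_word:
  assumes "(s = k + length u \<and> t = Suc s) \<or> (t = k + length u \<and> s = Suc t)"
  shows "col_move q s t (row_word k (u @ x # y # v)) = (if s < t then inverse q else 1) *\<^sub>s
      (row_word k u * (letter (x, t) * letter (y, t)) * row_word (k + length u + 2) v)"
proof -
  have "s \<notin> {k..<k + length u}" "t \<notin> {k..<k + length u}"
    "s \<notin> {k + length u + 2..<k + length u + 2 + length v}" "t \<notin> {k + length u + 2..<k + length u + 2 + length v}"
    using assms by auto
  note rules = col_move_row_word_0[OF this(1), of q t, unfolded col_move_def]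
    col_move_row_word_0[OF this(3), of q t, unfolded col_move_def, simplified]
    subst_col_twist_row_word_id[OF this(3,4), of q, simplified]
  have tw: "col_twist q s t (i, k) = shift_twist q s t k *\<^sub>s letter (i, k)" for i k
    by (simp add: col_twist_def twist_def)
  show ?thesis
  proof (cases "s < t")
    case True
    with assms have s: "s = k + length u" and t: "t = Suc (k + length u)" by auto
    show ?thesis
      using rules tw unfolding s t
      by (simp add: col_move_def row_word_append row_word_Cons skew_mult subst_mult
          shift_twist_simps scale_simps mult.assoc)
  next
    case False
    with assms have t: "t = k + length u" and s: "s = Suc (k + length u)" by auto
    show ?thesis
      using rules tw unfolding s t
      by (simp add: col_move_def row_word_append row_word_Cons skew_mult subst_mult
          shift_twist_simps scale_simps mult.assoc)
  qed
qed

text \<open>Words are paired by exchanging the rows in the two columns. After the move each pair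
  combines to a multiple of relation (2) in column \<open>t\<close>, so the image vanishes modulo
  the ideal only, in contrast to row moves.\<close>

lemma col_move_minor:
  fixes q :: "'k::field_char_0"
  assumes q: "q \<noteq> 0" and "I \<subseteq> R" "t \<in> C" and st: "s = Suc t \<or> t = Suc s"
    and d: "s \<in> {1..card I}" "t \<in> {1..card I}"
  shows "col_move q s t (minor q I) \<in> matrix_ideal q R C"
proof -
  let ?N = "matrix_ideal q R C"
  let ?F = "\<lambda>r. inverse (- q) ^ inversions r *\<^sub>s col_move q s t (row_word 1 r)"
  \<comment> \<open>The number of letters before the two columns, and also the list position of the
    left one: columns count from 1, list positions from 0.\<close>
  define m where "m = min s t - 1"
  have m: "(s = 1 + m \<and> t = Suc s) \<or> (t = 1 + m \<and> s = Suc t)" "Suc m < card I"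
    using st d by (auto simp: m_def)
  let ?\<phi> = "\<lambda>r. r[m := r ! Suc m, Suc m := r ! m]"
  have len: "length r = card I" if "r \<in> permutations_of_set I" for r
    using that by (rule length_finite_permutations_of_set)
  have \<phi>: "?\<phi> r \<in> permutations_of_set I" "?\<phi> (?\<phi> r) = r" if "r \<in> permutations_of_set I" for r
  proof -
    show "?\<phi> r \<in> permutations_of_set I"
      using that len[OF that] m by (auto simp: permutations_of_set_def)
    show "?\<phi> (?\<phi> r) = r"
      using len[OF that] m by (intro nth_equalityI) (auto simp: nth_list_update)
  qed
  have "bij_betw ?\<phi> (permutations_of_set I) (permutations_of_set I)"
    by (rule bij_betw_byWitness[of _ ?\<phi>]) (use \<phi> in auto)
  moreover have "?F r + ?F (?\<phi> r) \<in> ?N" if "r \<in> permutations_of_set I" for r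
  proof -
    define u v x y where "u = take m r" and "v = drop (Suc (Suc m)) r" and "x = r ! m" and "y = r ! Suc m"
    have r: "r = u @ x # y # v"
      using len[OF that] m by (simp add: u_def v_def x_def y_def Cons_nth_drop_Suc)
    have u: "length u = m"
      using len[OF that] m by (simp add: u_def)
    have \<phi>r: "?\<phi> r = u @ y # x # v"
      using u by (simp add: r list_update_append nth_append)
    have xy: "x \<noteq> y" "x \<in> R" "y \<in> R"
      using permutations_of_setD[OF that] r \<open>I \<subseteq> R\<close> by auto
    have pair: "?F (u @ x # y # v) + ?F (u @ y # x # v) \<in> ?N" if "x < y" "x \<in> R" "y \<in> R" for x y
    proof -
      let ?c = "inverse (- q) ^ inversions (u @ x # y # v) * (if s < t then inverse q else 1)"
      have "comm_rel q (y, t) (x, t) \<in> ?N"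
        using quantum_matrixD(2)[OF quantum_matrix_ideal] that \<open>t \<in> C\<close> by blast
      \<comment> \<open>The word with \<open>y\<close> before \<open>x\<close> has one more
        inversion, so its coefficient is \<open>?c\<close> times -1/q; factoring this out leaves
        exactly the column relation.\<close>
      then have "(- ?c * inverse q) *\<^sub>s (row_word 1 u * comm_rel q (y, t) (x, t) * row_word (1 + m + 2) v) \<in> ?N"
        by (intro ideal_gen_scale ideal_gen_mult_left ideal_gen_mult_right)
      also have "(- ?c * inverse q) *\<^sub>s (row_word 1 u * comm_rel q (y, t) (x, t) * row_word (1 + m + 2) v)
          = ?F (u @ x # y # v) + ?F (u @ y # x # v)"
        using col_move_row_word[of s 1 u t q] m(1) u q
        by (simp add: inversions_swap_entries[OF \<open>x < y\<close>] comm_rel_def algebra_simps scale_simps)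
      finally show ?thesis .
    qed
    show ?thesis
      unfolding \<phi>r using pair[of x y] pair[of y x] xy r by (cases x y rule: linorder_cases) (auto simp: add.commute)
  qed
  ultimately have "sum ?F (permutations_of_set I) \<in> ?N"
    by (rule sum_cancel_pairs[OF subspace_ideal_gen])
  then show ?thesis
    by (simp add: minor_def col_move_def skew_linear)
qed

section \<open>Quasi-commutation\<close>

definition qcomm :: "('x word \<Rightarrow>\<^sub>0 'k::field) set \<Rightarrow> 'k \<Rightarrow> ('x word \<Rightarrow>\<^sub>0 'k) \<Rightarrow> ('x word \<Rightarrow>\<^sub>0 'k) \<Rightarrow> bool"
  where "qcomm G c f g \<longleftrightarrow> f * g - c *\<^sub>s (g * f) \<in> ideal_gen G"

lemma qcomm_letters: "qcomm G c (letter x) (letter y) \<longleftrightarrow> comm_rel c x y \<in> ideal_gen G"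
  by (simp add: qcomm_def comm_rel_def)

lemma qcomm_self: "qcomm G 1 f f"
  by (simp add: qcomm_def ideal_gen.zero)

lemma qcomm_one: "qcomm G 1 1 g"
  by (simp add: qcomm_def ideal_gen.zero)

lemma qcomm_mono: "G \<subseteq> H \<Longrightarrow> qcomm G c f g \<Longrightarrow> qcomm H c f g"
  using ideal_gen_mono unfolding qcomm_def by blast

lemma qcomm_sym:
  assumes "qcomm G c f g" "c \<noteq> 0"
  shows "qcomm G (inverse c) g f"
proof -
  have "(- inverse c) *\<^sub>s (f * g - c *\<^sub>s (g * f)) \<in> ideal_gen G"
    using assms(1) unfolding qcomm_def by (rule ideal_gen_scale)
  then show ?thesis
    using assms(2) by (simp add: qcomm_def scale_simps)
qed

lemma qcomm_mult:
  assumes "qcomm G c f h" "qcomm G d g h"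
  shows "qcomm G (c * d) (f * g) h"
proof -
  have "f * (g * h - d *\<^sub>s (h * g)) + d *\<^sub>s ((f * h - c *\<^sub>s (h * f)) * g) \<in> ideal_gen G"
    using assms unfolding qcomm_def
    by (intro ideal_gen_add ideal_gen_mult_left ideal_gen_scale ideal_gen_mult_right)
  then show ?thesis
    by (simp add: qcomm_def algebra_simps scale_simps)
qed

lemma qcomm_mon:
  "(\<And>z. z \<in> set w \<Longrightarrow> qcomm G (\<mu> z) (letter z) g) \<Longrightarrow> qcomm G (prod_list (map \<mu> w)) (mon w) g"
  by (induction w) (simp_all add: qcomm_one mon_Cons qcomm_mult)

lemma qcomm_sum:
  assumes "\<And>a. a \<in> A \<Longrightarrow> qcomm G c (f a) g"
  shows "qcomm G c (\<Sum>a\<in>A. d a *\<^sub>s f a) g"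
proof -
  have "(\<Sum>a\<in>A. d a *\<^sub>s (f a * g - c *\<^sub>s (g * f a))) \<in> ideal_gen G"
    using assms unfolding qcomm_def by (intro ideal_gen_sum ideal_gen_scale)
  then show ?thesis
    by (simp add: qcomm_def sum_distrib_left sum_distrib_right scale_simps scale_sum sum_subtractf mult.commute)
qed

text \<open>Applying D to f g - c g f and dropping the terms with D(g) leaves D(f) g - c g D(f),
  because the twist fixes g. This is how one q-commutation relation produces another with the same
  factor.\<close>

lemma qcomm_skew:
  assumes "\<And>f. f \<in> ideal_gen G \<Longrightarrow> skew h \<delta> f \<in> ideal_gen G"
    and "skew h \<delta> g \<in> ideal_gen G" "subst h g = g" and fg: "qcomm G c f g"
  shows "qcomm G c (skew h \<delta> f) g"
proof -
  have "skew h \<delta> (f * g - c *\<^sub>s (g * f)) - f * skew h \<delta> g + c *\<^sub>s (skew h \<delta> g * subst h f) \<in> ideal_gen G"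
    using assms unfolding qcomm_def
    by (intro ideal_gen_add ideal_gen_diff ideal_gen_mult_left ideal_gen_scale ideal_gen_mult_right)
  then show ?thesis
    using assms(3) by (simp add: qcomm_def skew_linear skew_mult scale_simps)
qed

lemma prod_list_zip:
  "length u = length v \<Longrightarrow> prod_list (map (\<lambda>(x, y). f x * g y) (zip u v))
    = prod_list (map f u) * (prod_list (map g v) :: 'a::comm_monoid_mult)"
  by (induction rule: list_induct2) (simp_all add: ac_simps)

text \<open>Each word of the minor uses every row of \<open>I\<close> and every column up to
  \<open>card I\<close> once. If the factor of a letter splits into a row part and a column part,
  all words therefore have the same total factor.\<close>

lemma qcomm_minor:
  assumes "\<And>a l. a \<in> I \<Longrightarrow> l \<in> {1..card I} \<Longrightarrow> qcomm G (\<phi> a * \<psi> l) (letter (a, l)) g"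
  shows "qcomm G ((\<Prod>a\<in>I. \<phi> a) * (\<Prod>l\<in>{1..card I}. \<psi> l)) (minor q I) g"
  unfolding minor_def
proof (rule qcomm_sum)
  fix r assume r: "r \<in> permutations_of_set I"
  then have I: "set r = I" "distinct r" "length r = card I"
    by (simp_all add: permutations_of_setD length_finite_permutations_of_set)
  have "qcomm G (prod_list (map (\<lambda>(a, l). \<phi> a * \<psi> l) (zip r [1..<1 + length r]))) (row_word 1 r) g"
    unfolding row_word_def
  proof (rule qcomm_mon)
    fix z assume "z \<in> set (zip r [1..<1 + length r])"
    then obtain a l where z: "z = (a, l)" and "(a, l) \<in> set (zip r [1..<1 + length r])"
      by (metis surj_pair)
    then have "a \<in> I" "l \<in> {1..card I}"
      using I set_zip_leftD[of a l r] set_zip_rightD[of a l r] by fastforce+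
    then show "qcomm G (case z of (a, l) \<Rightarrow> \<phi> a * \<psi> l) (letter z) g"
      using assms z by simp
  qed
  moreover have "prod_list (map (\<lambda>(a, l). \<phi> a * \<psi> l) (zip r [1..<1 + length r]))
      = (\<Prod>a\<in>I. \<phi> a) * (\<Prod>l\<in>{1..card I}. \<psi> l)"
    using I by (simp add: prod_list_zip prod_list_distinct atLeastLessThanSuc_atLeastAtMost del: upt_Suc)
  ultimately show "qcomm G ((\<Prod>a\<in>I. \<phi> a) * (\<Prod>l\<in>{1..card I}. \<psi> l)) (row_word 1 r) g"
    by simp
qed

section \<open>Single entries against a minor\<close>

locale q_matrix =
  fixes q :: "'k::field_char_0" and n :: nat
  assumes q: "q \<noteq> 0"
begin

abbreviation rels :: "nat set \<Rightarrow> ((nat \<times> nat) word \<Rightarrow>\<^sub>0 'k) set"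
  where "rels R \<equiv> matrix_rels q R {1..n}"

lemma rels_mono: "R \<subseteq> R' \<Longrightarrow> rels R \<subseteq> rels R'"
  unfolding matrix_rels_def by (intro Un_mono; blast)

lemma letter_relations:
  assumes "i \<in> R" "k \<in> {1..n}"
  shows "l \<in> {1..n} \<Longrightarrow> k < l \<Longrightarrow> qcomm (rels R) q (letter (i, l)) (letter (i, k))"
    and "j \<in> R \<Longrightarrow> i < j \<Longrightarrow> qcomm (rels R) q (letter (j, k)) (letter (i, k))"
    and "j \<in> R \<Longrightarrow> l \<in> {1..n} \<Longrightarrow> i < j \<Longrightarrow> k < l \<Longrightarrow> qcomm (rels R) 1 (letter (j, k)) (letter (i, l))"
  using quantum_matrixD(1-3)[OF quantum_matrix_ideal assms] by (simp_all add: qcomm_letters)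

text \<open>An entry in column 1 and a row not above any row of \<open>I\<close> meets every letter
  of the minor in the same row, in the same column, or in the antidiagonal position of relation (3).
  Relation (4) never enters.\<close>

lemma qcomm_first_column:
  assumes I: "finite I" "I \<noteq> {}" "card I \<le> n" "\<And>i. i \<in> I \<Longrightarrow> i \<le> j" and R: "I \<subseteq> R" "j \<in> R"
  shows "qcomm (rels R) (if j \<in> I then 1 else q) (letter (j, 1)) (minor q I)"
proof -
  have n: "1 \<in> {1..n}" "{1..card I} \<subseteq> {1..n}" and d: "1 \<in> {1..card I}"
    using I by (auto simp: Suc_le_eq card_gt_0_iff intro: order.trans[of 1 "card I" n])
  \<comment> \<open>Row \<open>j\<close> contributes \<open>q\<close> and column 1 contributes
    \<open>inverse q\<close>; at the entry itself they cancel, as they must.\<close>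
  let ?\<phi> = "\<lambda>a. if a = j then q else 1" and ?\<psi> = "\<lambda>l::nat. if l = 1 then inverse q else 1"
  have "qcomm (rels R) (?\<phi> a * ?\<psi> l) (letter (a, l)) (letter (j, 1))"
    if "a \<in> I" "l \<in> {1..card I}" for a l
  proof -
    have l: "l \<in> {1..n}" "l \<noteq> 1 \<Longrightarrow> 1 < l" and a: "a \<in> R" "a \<noteq> j \<Longrightarrow> a < j"
      using that n I(4) R by (auto simp: le_less)
    consider "a = j" "l = 1" | "a = j" "l \<noteq> 1" | "a \<noteq> j" "l = 1" | "a \<noteq> j" "l \<noteq> 1"
      by blast
    then show ?thesis
    proof cases
      case 1
      then show ?thesis using q by (simp add: qcomm_self)
    next
      case 2
      then show ?thesis using letter_relations(1)[OF a(1) n(1) l(1)] l by simp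
    next
      case 3
      then show ?thesis
        using qcomm_sym[OF letter_relations(2)[OF a(1) n(1) R(2)]] a q by simp
    next
      case 4
      then show ?thesis
        using qcomm_sym[OF letter_relations(3)[OF a(1) n(1) R(2) l(1)]] a l by simp
    qed
  qed
  from qcomm_minor[of I "rels R" ?\<phi> ?\<psi> "letter (j, 1)" q, OF this]
  have "qcomm (rels R) ((if j \<in> I then q else 1) * inverse q) (minor q I) (letter (j, 1))"
    using I d by (simp add: prod.delta)
  from qcomm_sym[OF this] q show ?thesis by (auto split: if_splits)
qed

text \<open>The mirror image: the entry lies above all rows of \<open>I\<close> and in the last
  column of the minor, so again only relations (2) and (3) occur.\<close>

lemma qcomm_last_column:
  assumes I: "finite I" "I \<noteq> {}" "card I \<le> n" "\<And>i. i \<in> I \<Longrightarrow> j < i" and R: "I \<subseteq> R" "j \<in> R"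
  shows "qcomm (rels R) (inverse q) (letter (j, card I)) (minor q I)"
proof -
  have n: "card I \<in> {1..n}" "{1..card I} \<subseteq> {1..n}" and d: "card I \<in> {1..card I}"
    using I by (auto simp: Suc_le_eq card_gt_0_iff)
  let ?\<psi> = "\<lambda>l::nat. if l = card I then q else 1"
  have "qcomm (rels R) (1 * ?\<psi> l) (letter (a, l)) (letter (j, card I))"
    if "a \<in> I" "l \<in> {1..card I}" for a l
  proof (cases "l = card I")
    case True
    then show ?thesis using letter_relations(2)[OF R(2) n(1)] that I(4) R(1) by auto
  next
    case False
    then show ?thesis
      using letter_relations(3)[of j R l a "card I"] that I(4) R n by auto
  qed
  from qcomm_minor[of I "rels R" "\<lambda>_. 1" ?\<psi> "letter (j, card I)" q, OF this]
  have "qcomm (rels R) q (minor q I) (letter (j, card I))"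
    using I d by (simp add: prod.delta)
  from qcomm_sym[OF this q] show ?thesis .
qed

text \<open>The column move sends the entry to the neighbouring column, while the minor is
  annihilated modulo the ideal and fixed by the twist.\<close>

lemma qcomm_next_column:
  assumes I: "card I \<le> n" "I \<subseteq> R" and kl: "l = Suc k \<or> k = Suc l" "k \<in> {1..card I}" "l \<in> {1..card I}"
    and k: "qcomm (rels R) c (letter (j, k)) (minor q I)"
  shows "qcomm (rels R) c (letter (j, l)) (minor q I)"
proof -
  have "qcomm (rels R) c (col_move q k l (letter (j, k))) (minor q I)"
    unfolding col_move_def
  proof (rule qcomm_skew[OF _ _ _ k])
    show "skew (col_twist q k l) (\<lambda>(i, ka). if ka = k then letter (i, l) else 0) f \<in> matrix_ideal q R {1..n}"
      if "f \<in> matrix_ideal q R {1..n}" for f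
      unfolding col_move_def[symmetric]
      by (rule col_move_ideal[OF q _ _ _ _ that]) (use kl I in \<open>auto simp: between_def\<close>)
    show "skew (col_twist q k l) (\<lambda>(i, ka). if ka = k then letter (i, l) else 0) (minor q I) \<in> matrix_ideal q R {1..n}"
      unfolding col_move_def[symmetric]
      by (rule col_move_minor) (use kl I q in auto)
    show "subst (col_twist q k l) (minor q I) = minor q I"
      by (rule subst_col_twist_minor) (use kl q in auto)
  qed
  then show ?thesis by (simp add: col_move_def)
qed

lemma qcomm_all_columns:
  assumes I: "card I \<le> n" "I \<subseteq> R" and k: "qcomm (rels R) c (letter (j, k)) (minor q I)"
    "k \<in> {1..card I}" "l \<in> {1..card I}"
  shows "qcomm (rels R) c (letter (j, l)) (minor q I)"
proof (cases "k \<le> l")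
  case True
  then show ?thesis using k(3)
  proof (induction l rule: dec_induct)
    case (step l)
    then show ?case using qcomm_next_column[OF I, of "Suc l" l] k(2) by auto
  qed (rule k(1))
next
  case False
  then have "l \<le> k" by simp
  then show ?thesis using k(3)
  proof (induction l rule: inc_induct)
    case (step l)
    then show ?case using qcomm_next_column[OF I, of l "Suc l"] k(2) by auto
  qed (rule k(1))
qed

text \<open>The minor of \<open>J\<close> is annihilated by the move and fixed by the twist, whether
  \<open>s\<close> and \<open>t\<close> both lie in \<open>J\<close> or both lie outside.\<close>

lemma qcomm_row_move:
  assumes st: "s \<in> R" "t \<in> R" "s \<noteq> t" "R \<inter> between s t = {}"
    and J: "finite J" "s \<in> J \<longleftrightarrow> t \<in> J" "J \<subseteq> R" and f: "qcomm (rels R) c f (minor q J)"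
  shows "qcomm (rels R) c (row_move q s t f) (minor q J)"
  unfolding row_move_def
proof (rule qcomm_skew[OF _ _ _ f], unfold row_move_def[symmetric])
  show "row_move q s t f \<in> matrix_ideal q R {1..n}" if "f \<in> matrix_ideal q R {1..n}" for f
    using row_move_ideal[OF q st that] .
  have "J \<inter> between s t = {}" using st J by blast
  then have "row_move q s t (minor q J) = 0"
    using row_move_minor_0[of s J q t] row_move_minor_both[OF q, of s J t] st J by blast
  then show "row_move q s t (minor q J) \<in> matrix_ideal q R {1..n}"
    by (simp add: ideal_gen.zero)
  show "subst (row_twist q s t) (minor q J) = minor q J"
    by (rule subst_row_twist_minor[OF J(1) q st(3) J(2)])
qed

text \<open>Centrality of the quantum determinant of the square submatrix. The bottom row is
  \<open>qcomm_first_column\<close>; row moves from each row of \<open>I\<close> to the preceding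
  one carry it upwards. With relations among rows of \<open>I\<close> only, consecutive rows of
  \<open>I\<close> count as adjacent.\<close>

lemma qcomm_row_inside:
  assumes I: "finite I" "card I \<le> n" "j \<in> I" "k \<in> {1..card I}"
  shows "qcomm (rels I) 1 (letter (j, k)) (minor q I)"
  using I(3)
proof (induction "Max I - j" arbitrary: j rule: less_induct)
  case less
  show ?case
  proof (cases "j = Max I")
    case True
    have "qcomm (rels I) 1 (letter (j, 1)) (minor q I)"
      using qcomm_first_column[of I j I] I less.prems True by auto
    then show ?thesis
      by (rule qcomm_all_columns[OF I(2) subset_refl]) (use I in auto)
  next
    case False
    then have j: "j < Max I"
      using I(1) less.prems by (simp add: le_neq_implies_less)
    define s where "s = Min {i \<in> I. j < i}"
    have ne: "{i \<in> I. j < i} \<noteq> {}" "finite {i \<in> I. j < i}"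
      using j I(1) Max_in[of I] less.prems by (blast, simp)
    have s: "s \<in> I" "j < s" using Min_in[OF ne(2,1)] by (auto simp: s_def)
    have "I \<inter> between s j = {}"
      using s Min_le[OF ne(2)] by (force simp: between_def s_def[symmetric])
    moreover have "qcomm (rels I) 1 (letter (s, k)) (minor q I)"
      by (rule less.hyps) (use s j Max_ge[OF I(1) s(1)] in auto)
    ultimately have "qcomm (rels I) 1 (row_move q s j (letter (s, k))) (minor q I)"
      using s I less.prems by (intro qcomm_row_move) auto
    then show ?thesis by (simp add: row_move_def)
  qed
qed

section \<open>Minors against minors\<close>

lemma qcomm_separated:
  assumes fin: "finite I" "finite J" and I: "I \<noteq> {}" "card I \<le> n" "card J \<le> card I"
    and J: "J - I = P \<union> Q" "\<And>p i. p \<in> P \<Longrightarrow> i \<in> I \<Longrightarrow> p < i" "\<And>p i. p \<in> Q \<Longrightarrow> i \<in> I \<Longrightarrow> i < p"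
    and R: "I \<union> J \<subseteq> R"
  shows "qcomm (rels R) (inverse q ^ card P * q ^ card Q) (minor q J) (minor q I)"
proof -
  \<comment> \<open>The factor depends on the row only: 1 inside \<open>I\<close>,
    \<open>inverse q\<close> below every element of \<open>I\<close>, and \<open>q\<close> above; it
    is the same in all columns of the smaller minor since
    \<open>card J \<le> card I\<close>.\<close>
  let ?\<phi> = "\<lambda>j. (if j \<in> P then inverse q else 1) * (if j \<in> Q then q else 1)"
  obtain i0 where i0: "i0 \<in> I" using I(1) by blast
  have disj: "P \<inter> Q = {}" using J(2)[OF _ i0] J(3)[OF _ i0] by (metis disjoint_iff less_asym)
  have "qcomm (rels R) (?\<phi> j * 1) (letter (j, k)) (minor q I)"
    if "j \<in> J" "k \<in> {1..card J}" for j k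
  proof -
    have k: "k \<in> {1..card I}" and d: "1 \<in> {1..card I}" "card I \<in> {1..card I}"
      using that I fin(1) by (auto simp: Suc_le_eq card_gt_0_iff)
    have "j \<in> I \<or> j \<in> P \<union> Q" using that(1) by (simp flip: J(1))
    then consider "j \<in> I" | "j \<in> P" | "j \<in> Q" by blast
    then show ?thesis
    proof cases
      case 1
      moreover have "rels I \<subseteq> rels R" using R by (intro rels_mono) blast
      moreover have "j \<notin> P" "j \<notin> Q" using 1 J(1) by auto
      ultimately show ?thesis
        using qcomm_mono[OF _ qcomm_row_inside[OF fin(1) I(2) 1 k]] by simp
    next
      case 2
      have "qcomm (rels R) (inverse q) (letter (j, card I)) (minor q I)"
        by (rule qcomm_last_column) (use 2 J R fin I that in auto)
      from qcomm_all_columns[OF I(2) _ this d(2) k] show ?thesis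
        using 2 disj R by auto
    next
      case 3
      then have "j \<notin> I" using J(1) by blast
      have "qcomm (rels R) (if j \<in> I then 1 else q) (letter (j, 1)) (minor q I)"
        by (rule qcomm_first_column) (use 3 J R fin I that in \<open>auto intro: less_imp_le\<close>)
      then have "qcomm (rels R) q (letter (j, 1)) (minor q I)"
        using \<open>j \<notin> I\<close> by simp
      from qcomm_all_columns[OF I(2) _ this d(1) k] show ?thesis
        using 3 disj R by auto
    qed
  qed
  from qcomm_minor[of J "rels R" ?\<phi> "\<lambda>_. 1" "minor q I" q, OF this]
  have "qcomm (rels R) (\<Prod>j\<in>J. ?\<phi> j) (minor q J) (minor q I)" by simp
  moreover have "(\<Prod>j\<in>J. ?\<phi> j) = inverse q ^ card P * q ^ card Q"
  proof -
    have "J \<inter> P = P" "J \<inter> Q = Q" using J(1) by auto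
    then show ?thesis
      using fin(2) by (simp add: prod.distrib flip: prod.inter_restrict)
  qed
  ultimately show ?thesis by simp
qed

text \<open>\<open>R\<close> and \<open>J\<close> stay fixed while \<open>P\<close> and
  \<open>Q\<close> vary; the left minor has rows \<open>R - (P \<union> Q)\<close>, so exchanging an
  element of \<open>P\<close> or \<open>Q\<close> with one of \<open>I\<close> preserves
  \<open>R - J\<close> and all cardinalities. Exchanges push \<open>P\<close> down and
  \<open>Q\<close> up until \<open>qcomm_separated\<close> applies.\<close>

lemma qcomm_minors:
  assumes R: "finite R" "J \<subseteq> R" and PQ: "P \<subseteq> J" "Q \<subseteq> J"
    and ne: "R - J \<noteq> {}" and P: "\<And>p a. p \<in> P \<Longrightarrow> a \<in> R - J \<Longrightarrow> p < a"
    and Q: "\<And>p a. p \<in> Q \<Longrightarrow> a \<in> R - J \<Longrightarrow> a < p"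
    and card: "card J \<le> card (R - (P \<union> Q))" "card (R - (P \<union> Q)) \<le> n"
  shows "qcomm (rels R) (q ^ card P * inverse q ^ card Q) (minor q (R - (P \<union> Q))) (minor q J)"
  using PQ P Q card
\<comment> \<open>The measure falls when an element of \<open>P\<close> decreases or one of
  \<open>Q\<close> increases; \<open>Max R\<close> only serves to reverse the order.\<close>
proof (induction "sum id P + (\<Sum>x\<in>Q. Max R - x)" arbitrary: P Q rule: less_induct)
  case less
  define I where "I = R - (P \<union> Q)"
  obtain a where a: "a \<in> R - J" using ne by blast
  have fin: "finite I" "finite J" "finite P" "finite Q"
    using R less.prems(1,2) by (auto simp: I_def intro: finite_subset)
  have aI: "a \<in> I" using a less.prems(1,2) by (auto simp: I_def)
  have disj: "P \<inter> Q = {}" using less.prems(3)[OF _ a] less.prems(4)[OF _ a] by (metis disjoint_iff less_asym)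
  \<comment> \<open>Undoing an exchange: moving row \<open>p\<close> to row \<open>b\<close> turns
    the exchanged minor back into that of \<open>I\<close>. Both rows lie in \<open>J\<close>, so
    the factor is unchanged.\<close>
  have move: "qcomm (rels R) c (minor q I) (minor q J)"
    if "qcomm (rels R) c (minor q (insert p (I - {b}))) (minor q J)"
      "p \<in> J" "p \<notin> I" "b \<in> J" "b \<in> I" "R \<inter> between p b = {}" for c p b
  proof -
    have "p \<in> R" "b \<in> R" "p \<noteq> b" using that R by auto
    then have "qcomm (rels R) c (row_move q p b (minor q (insert p (I - {b})))) (minor q J)"
      using that fin R by (intro qcomm_row_move) auto
    moreover have "insert b (insert p (I - {b}) - {p}) = I" using that by auto
    moreover have "insert p (I - {b}) \<subseteq> R" using \<open>p \<in> R\<close> by (auto simp: I_def)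
    then have "insert p (I - {b}) \<inter> between p b = {}" using that by blast
    ultimately show ?thesis
      using row_move_minor_single[of p "insert p (I - {b})" b q] \<open>p \<noteq> b\<close> by simp
  qed
  consider (left) "\<exists>p\<in>P. \<exists>b\<in>I. b < p" | (right) "\<exists>p\<in>Q. \<exists>b\<in>I. p < b"
    | (separated) "\<And>p b. p \<in> P \<Longrightarrow> b \<in> I \<Longrightarrow> p < b" "\<And>p b. p \<in> Q \<Longrightarrow> b \<in> I \<Longrightarrow> b < p"
  proof -
    have "p \<noteq> b" if "p \<in> P \<union> Q" "b \<in> I" for p b using that by (auto simp: I_def)
    then show ?thesis using that by (metis UnCI linorder_neqE_nat)
  qed
  then show ?case
  proof cases
    case separated
    have "J - I = P \<union> Q" using less.prems R by (auto simp: I_def)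
    then have "qcomm (rels R) (inverse q ^ card P * q ^ card Q) (minor q J) (minor q I)"
      using separated fin less.prems aI R by (intro qcomm_separated) (auto simp: I_def)
    from qcomm_sym[OF this] q show ?thesis
      by (simp add: I_def power_inverse)
  next
    case left
    \<comment> \<open>The smallest offending \<open>p\<close> and the largest \<open>b\<close> of
      \<open>I\<close> below it are adjacent in \<open>R\<close>: \<open>b\<close> excludes elements
      of \<open>I\<close> between them, minimality of \<open>p\<close> excludes \<open>P\<close>,
      and \<open>Q\<close> lies above \<open>a\<close>.\<close>
    have "finite {p \<in> P. \<exists>b\<in>I. b < p}" "{p \<in> P. \<exists>b\<in>I. b < p} \<noteq> {}"
      using left fin by auto
    from Min_in[OF this] Min_le[OF this(1)]
    obtain p where p: "p \<in> P" "\<exists>b\<in>I. b < p" and pmin: "\<And>x. x \<in> P \<Longrightarrow> \<exists>b\<in>I. b < x \<Longrightarrow> p \<le> x"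
      by blast
    have "finite {b \<in> I. b < p}" "{b \<in> I. b < p} \<noteq> {}"
      using p fin by auto
    from Max_in[OF this] Max_ge[OF this(1)]
    obtain b where b: "b \<in> I" "b < p" and bmax: "\<And>x. x \<in> I \<Longrightarrow> x < p \<Longrightarrow> x \<le> b"
      by blast
    have "p < a" by (rule less.prems(3)[OF p(1) a])
    \<comment> \<open>An element of \<open>R\<close> outside \<open>J\<close> would have to be
      larger than \<open>p\<close>.\<close>
    have bJ: "b \<in> J"
      using less.prems(3)[OF p(1), of b] b by (auto simp: I_def)
    have nb: "R \<inter> between p b = {}"
    proof -
      have False if x: "x \<in> R" "b < x" "x < p" for x
      proof -
        have "x \<notin> I" using bmax x by force
        moreover have "x \<notin> P" using pmin[of x] x b by force
        moreover have "x \<notin> Q" using less.prems(4)[OF _ a, of x] x \<open>p < a\<close> by force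
        ultimately show False using x by (auto simp: I_def)
      qed
      then show ?thesis using b by (auto simp: between_def)
    qed
    define P' where "P' = insert b (P - {p})"
    have b': "b \<notin> P" "b \<notin> Q" using b by (auto simp: I_def)
    have "sum id P' < sum id P"
      using b b' fin sum.remove[OF fin(3) p(1), of id] by (simp add: P'_def)
    have card': "card P' = card P"
      using b b' fin card.remove[OF fin(3) p(1)] by (simp add: P'_def)
    have pQ: "p \<notin> Q" using p disj by blast
    have I': "R - (P' \<union> Q) = insert p (I - {b})"
      using p b pQ less.prems(1) R by (auto simp: I_def P'_def)
    have cardI': "card (R - (P' \<union> Q)) = card I"
      unfolding I' using b fin p card.remove[OF fin(1) b(1)] by (simp add: I_def)
    have "qcomm (rels R) (q ^ card P' * inverse q ^ card Q) (minor q (R - (P' \<union> Q))) (minor q J)"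
    proof (rule less.hyps)
      show "sum id P' + (\<Sum>x\<in>Q. Max R - x) < sum id P + (\<Sum>x\<in>Q. Max R - x)"
        using \<open>sum id P' < sum id P\<close> by simp
      show "P' \<subseteq> J" using less.prems(1) bJ by (auto simp: P'_def)
      show "x < c" if "x \<in> P'" "c \<in> R - J" for x c
        using that less.prems(3)[OF _ that(2)] p(1) b(2) by (auto simp: P'_def intro: less_trans)
    qed (use less.prems cardI' in \<open>simp_all add: I_def\<close>)
    then show ?thesis
      unfolding card' I' I_def[symmetric]
      by (rule move) (use p b bJ nb less.prems(1) in \<open>auto simp: I_def\<close>)
  next
    case right
    \<comment> \<open>The same argument with the order reversed: the largest offending
      \<open>p\<close> and the smallest \<open>b\<close> of \<open>I\<close> above it.\<close>
    have "finite {p \<in> Q. \<exists>b\<in>I. p < b}" "{p \<in> Q. \<exists>b\<in>I. p < b} \<noteq> {}"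
      using right fin by auto
    from Max_in[OF this] Max_ge[OF this(1)]
    obtain p where p: "p \<in> Q" "\<exists>b\<in>I. p < b" and pmax: "\<And>x. x \<in> Q \<Longrightarrow> \<exists>b\<in>I. x < b \<Longrightarrow> x \<le> p"
      by blast
    have "finite {b \<in> I. p < b}" "{b \<in> I. p < b} \<noteq> {}"
      using p fin by auto
    from Min_in[OF this] Min_le[OF this(1)]
    obtain b where b: "b \<in> I" "p < b" and bmin: "\<And>x. x \<in> I \<Longrightarrow> p < x \<Longrightarrow> b \<le> x"
      by blast
    have "a < p" by (rule less.prems(4)[OF p(1) a])
    have bJ: "b \<in> J"
      using less.prems(4)[OF p(1), of b] b by (auto simp: I_def)
    have nb: "R \<inter> between p b = {}"
    proof -
      have False if x: "x \<in> R" "p < x" "x < b" for x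
      proof -
        have "x \<notin> I" using bmin x by force
        moreover have "x \<notin> Q" using pmax[of x] x b by force
        moreover have "x \<notin> P" using less.prems(3)[OF _ a, of x] x \<open>a < p\<close> by force
        ultimately show False using x by (auto simp: I_def)
      qed
      then show ?thesis using b by (auto simp: between_def)
    qed
    define Q' where "Q' = insert b (Q - {p})"
    have b': "b \<notin> P" "b \<notin> Q" "b \<in> R" using b by (auto simp: I_def)
    have "(\<Sum>x\<in>Q'. Max R - x) < (\<Sum>x\<in>Q. Max R - x)"
      using b b' fin sum.remove[OF fin(4) p(1), of "\<lambda>x. Max R - x"] Max_ge[OF R(1) b'(3)]
      by (simp add: Q'_def)
    have card': "card Q' = card Q"
      using b b' fin card.remove[OF fin(4) p(1)] by (simp add: Q'_def)
    have pP: "p \<notin> P" using p disj by blast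
    have I': "R - (P \<union> Q') = insert p (I - {b})"
      using p b pP less.prems(2) R by (auto simp: I_def Q'_def)
    have cardI': "card (R - (P \<union> Q')) = card I"
      unfolding I' using b fin p card.remove[OF fin(1) b(1)] by (simp add: I_def)
    have "qcomm (rels R) (q ^ card P * inverse q ^ card Q') (minor q (R - (P \<union> Q'))) (minor q J)"
    proof (rule less.hyps)
      show "sum id P + (\<Sum>x\<in>Q'. Max R - x) < sum id P + (\<Sum>x\<in>Q. Max R - x)"
        using \<open>(\<Sum>x\<in>Q'. Max R - x) < _\<close> by simp
      show "Q' \<subseteq> J" using less.prems(2) bJ by (auto simp: Q'_def)
      show "c < x" if "x \<in> Q'" "c \<in> R - J" for x c
        using that less.prems(4)[OF _ that(2)] p(1) b(2) by (auto simp: Q'_def intro: less_trans)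
    qed (use less.prems cardI' in \<open>simp_all add: I_def\<close>)
    then show ?thesis
      unfolding card' I' I_def[symmetric]
      by (rule move) (use p b bJ nb less.prems(2) in \<open>auto simp: I_def\<close>)
  qed
qed

lemma qcomm_surrounds:
  assumes fin: "finite I" "finite J" and card: "card J \<le> card I" "card I \<le> n"
    and split: "surround_split J I J' J''"
  shows "qcomm (rels (I \<union> J)) (q powi (int (card J'') - int (card J'))) (minor q J) (minor q I)"
proof (cases "I - J = {}")
  case True
  \<comment> \<open>Conditions (b) and (c) are vacuous in this case; the cardinality bound settles
    it.\<close>
  then have "I = J" using fin card by (metis Diff_eq_empty_iff card_seteq)
  with split have "J' = {}" "J'' = {}" by (auto simp: surround_split_def)
  then show ?thesis using \<open>I = J\<close> by (simp add: qcomm_self)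
next
  case False
  have I: "I \<union> J - (J' \<union> J'') = I" and RJ: "I \<union> J - J = I - J"
    using split by (auto simp: surround_split_def)
  have "qcomm (rels (I \<union> J)) (q ^ card J' * inverse q ^ card J'') (minor q (I \<union> J - (J' \<union> J''))) (minor q J)"
    using fin card split False
    by (intro qcomm_minors) (auto simp: I RJ surround_split_def)
  \<comment> \<open>\<open>qcomm_minors\<close> puts the minor of \<open>I\<close> on the left,
    where the moves act; reversing the factors inverts the power of \<open>q\<close>.\<close>
  then have "qcomm (rels (I \<union> J)) (inverse (q ^ card J' * inverse q ^ card J'')) (minor q J) (minor q I)"
    unfolding I by (rule qcomm_sym) (use q in simp)
  moreover have "inverse (q ^ card J' * inverse q ^ card J'') = q powi (int (card J'') - int (card J'))"
    using q by (simp add: power_int_diff power_inverse divide_inverse)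
  ultimately show ?thesis by simp
qed

end

section \<open>Transfer to the quantum matrix algebra\<close>

lemma free_algebra_closed:
  fixes S :: "'x set" and f g :: "'x word \<Rightarrow>\<^sub>0 'k::field"
  assumes "f \<in> carrier (free_algebra S)" "g \<in> carrier (free_algebra S)"
  shows "f + g \<in> carrier (free_algebra S)" "f * g \<in> carrier (free_algebra S)"
    "f - g \<in> carrier (free_algebra S)"
proof -
  interpret ring "free_algebra S :: ('k, 'x word \<Rightarrow>\<^sub>0 'k) module"
    by (rule ring_free_algebra)
  show "f + g \<in> carrier (free_algebra S)" "f * g \<in> carrier (free_algebra S)"
    using a_closed[OF assms] m_closed[OF assms] by simp_all
  have "- g \<in> carrier (free_algebra S)"
    using assms(2) by simp
  then show "f - g \<in> carrier (free_algebra S)"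
    using a_closed[OF assms(1)] by (metis diff_conv_add_uminus free_algebra_simps(4))
qed

lemma free_algebra_scale: "f \<in> carrier (free_algebra S) \<Longrightarrow> c *\<^sub>s f \<in> carrier (free_algebra S)"
  using free_algebra_closed(2)[of "Poly_Mapping.single 0 c" S f] by (simp add: scale_def zero_word_def)

lemma mon_in_free_algebra: "set w \<subseteq> S \<Longrightarrow> mon w \<in> carrier (free_algebra S)"
  by (simp add: mon_def)

lemma sum_in_free_algebra:
  "(\<And>a. a \<in> A \<Longrightarrow> f a \<in> carrier (free_algebra S)) \<Longrightarrow> sum f A \<in> carrier (free_algebra S)"
  by (induction A rule: infinite_finite_induct) (simp_all add: free_algebra_closed del: free_algebra_simps(1), simp_all)

text \<open>\<^const>\<open>matrix_ideal\<close> is an ideal of the free algebra on all of \<open>nat \<times> nat\<close>, whereas \<^const>\<open>q_ideal\<close>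
  lives in the free algebra on \<open>[n] \<times> [n]\<close>; the retraction killing the other letters maps one to the other.\<close>

definition retract :: "'x set \<Rightarrow> ('x word \<Rightarrow>\<^sub>0 'k::field) \<Rightarrow> ('x word \<Rightarrow>\<^sub>0 'k)"
  where "retract S = subst (\<lambda>x. if x \<in> S then letter x else 0)"

lemma retract_in_free_algebra: "retract S f \<in> carrier (free_algebra S)"
proof (induction f rule: free_algebra_induct)
  case zero
  then show ?case by (simp add: retract_def)
next
  case (add c w f)
  have "prod_list (map (\<lambda>x. if x \<in> S then letter x else 0) w) \<in> carrier (free_algebra S)"
  proof (induction w)
    case Nil
    then show ?case by (simp add: zero_word_def)
  next
    case (Cons x w)
    then show ?case
      using free_algebra_closed(2)[OF letter_in_carrier Cons.IH] by auto
  qed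
  then show ?case
    using add unfolding retract_def subst_linear word.sel
    by (intro free_algebra_closed(1) free_algebra_scale)
qed

lemma retract_id:
  assumes "f \<in> carrier (free_algebra S)"
  shows "retract S f = f"
proof -
  have mon: "prod_list (map (\<lambda>x. if x \<in> S then letter x else 0) w) = mon w" if "set w \<subseteq> S" for w
    using that by (induction w) (simp_all add: mon_Cons)
  have "retract S f = lin (\<lambda>w. mon (letters w)) f"
    unfolding retract_def subst_def lin_def using assms by (intro sum.cong) (simp_all add: mon)
  also have "\<dots> = f"
    by (induction f rule: free_algebra_induct) (simp_all add: lin_simps)
  finally show ?thesis .
qed

text \<open>The retraction fixes \<open>f\<close> and all relations, so it turns an expression of
  \<open>f\<close> through the relations into one whose outer factors lie in the smaller
  algebra.\<close>

lemma matrix_ideal_q_ideal: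
  fixes q :: "'k::field"
  assumes f: "f \<in> matrix_ideal q {1..n} {1..n}" "f \<in> carrier (free_matrix_algebra n)"
  shows "f \<in> q_ideal n q"
proof -
  let ?F = "free_matrix_algebra n :: ('k, _) module" and ?S = "{1..n} \<times> {1..n}"
  interpret ideal "q_ideal n q" ?F by (rule ideal_q_ideal)
  let ?x = "\<lambda>a b. letter (a, b) :: _ \<Rightarrow>\<^sub>0 'k"
  note rel = q_relations_in_q_ideal[of _ _ n q, unfolded q_relations_def free_algebra_simps(2,4,6)]
  have "quantum_matrix (q_ideal n q) q {1..n} {1..n} Pair"
    unfolding quantum_matrix_def comm_rel_def cross_rel_def scale_def
    by (intro conjI ballI impI rel;
        (simp only: Un_iff mem_Collect_eq prod.inject single_one mult_1)?; blast)
  then have rels: "matrix_rels q {1..n} {1..n} \<subseteq> q_ideal n q"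
    unfolding quantum_matrix_iff .
  from f(1) have "retract ?S f \<in> q_ideal n q"
  proof induction
    case zero
    then show ?case
      using additive_subgroup.zero_closed[OF is_additive_subgroup] by (simp add: retract_def)
  next
    case (step g h a b)
    have g: "g \<in> q_ideal n q" using rels step.hyps(1) by blast
    then have "retract ?S g = g"
      using a_subset by (intro retract_id) blast
    have "retract ?S a * g \<in> q_ideal n q"
      using I_l_closed[OF g retract_in_free_algebra] by simp
    then have "retract ?S a * g * retract ?S b \<in> q_ideal n q"
      using I_r_closed[OF _ retract_in_free_algebra] by simp
    moreover have "retract ?S (a * g * b + h) = retract ?S a * g * retract ?S b + retract ?S h"
      using \<open>retract ?S g = g\<close> by (simp add: retract_def subst_linear subst_mult)
    ultimately show ?case
      using additive_subgroup.a_closed[OF is_additive_subgroup _ step.IH] by simp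
  qed
  then show ?thesis
    using retract_id[OF f(2)] by simp
qed

section \<open>Identification of \<open>minor\<close> with the quantum minor\<close>

lemma inversions_map_upt:
  "inversions (map f [a..<b]) = card {(i, j). i \<in> {a..<b} \<and> j \<in> {a..<b} \<and> i < j \<and> f j < f i}"
proof (cases "a \<le> b")
  case True
  then show ?thesis
  proof (induction a rule: inc_induct)
    case (step a)
    let ?A = "{a} \<times> {j \<in> {Suc a..<b}. f j < f a}"
    let ?B = "{(i, j). i \<in> {Suc a..<b} \<and> j \<in> {Suc a..<b} \<and> i < j \<and> f j < f i}"
    have "{(i, j). i \<in> {a..<b} \<and> j \<in> {a..<b} \<and> i < j \<and> f j < f i} = ?A \<union> ?B"
      using step.hyps by (auto simp: Suc_le_eq le_less)
    moreover have "finite ?B"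
      by (rule finite_subset[of _ "{Suc a..<b} \<times> {Suc a..<b}"]) auto
    then have "card (?A \<union> ?B) = card ?A + card ?B"
      by (intro card_Un_disjoint) auto
    moreover have "length (filter (\<lambda>y. y < f a) (map f [Suc a..<b])) = card ?A"
      by (simp add: filter_map distinct_length_filter comp_def Int_def conj_commute del: upt_Suc)
    ultimately show ?case
      using step.IH step.hyps by (simp add: upt_conv_Cons)
  qed simp
qed simp

text \<open>A permutation is sent to the list of rows i_sigma(1), ..., i_sigma(d); the shift by one
  reflects list positions starting at 0. The map is injective and both sides have d!
  elements.\<close>

lemma permutes_list_bij:
  fixes I :: "nat set"
  assumes "finite I"
  defines "d \<equiv> card I" and "L \<equiv> sorted_list_of_set I"
  shows "bij_betw (\<lambda>\<sigma>. map (\<lambda>a. L ! (\<sigma> a - 1)) [1..<d + 1]) {\<sigma>. \<sigma> permutes {1..d}} (permutations_of_set I)"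
    (is "bij_betw ?f ?P ?Q")
proof -
  have L: "distinct L" "set L = I" "length L = d"
    using assms by (simp_all add: L_def)
  have inj: "inj_on (\<lambda>a. L ! (a - 1)) {1..d}"
    using L by (auto simp: inj_on_def nth_eq_iff_index_eq)
  have img: "(\<lambda>a. L ! (a - 1)) ` {1..d} = I"
  proof -
    have "{1..d} = Suc ` {0..<d}"
      by (simp add: image_Suc_atLeastLessThan atLeastLessThanSuc_atLeastAtMost)
    then have "(\<lambda>a. L ! (a - 1)) ` {1..d} = (!) L ` {0..<d}"
      by (simp only: image_image diff_Suc_1)
    then show ?thesis using L by (auto simp: set_conv_nth)
  qed
  have "?f ` ?P \<subseteq> ?Q"
  proof clarify
    fix \<sigma> assume \<sigma>: "\<sigma> permutes {1..d}"
    have "set [1..<d + 1] = {1..d}" by auto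
    moreover have "inj_on (\<lambda>a. L ! (\<sigma> a - 1)) {1..d}"
      using comp_inj_on[of \<sigma> "{1..d}" "\<lambda>a. L ! (a - 1)", OF permutes_inj_on[OF \<sigma>]] inj permutes_image[OF \<sigma>]
      by (simp add: comp_def)
    moreover have "(\<lambda>a. L ! (\<sigma> a - 1)) ` {1..d} = I"
      using img image_image[of "\<lambda>a. L ! (a - 1)" \<sigma> "{1..d}"] unfolding permutes_image[OF \<sigma>] by simp
    ultimately show "?f \<sigma> \<in> ?Q"
      by (simp add: permutations_of_set_def distinct_map del: upt_Suc)
  qed
  moreover have "inj_on ?f ?P"
  proof (rule inj_onI, clarify)
    fix \<sigma> \<tau> assume \<sigma>: "\<sigma> permutes {1..d}" and \<tau>: "\<tau> permutes {1..d}" and eq: "?f \<sigma> = ?f \<tau>"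
    show "\<sigma> = \<tau>"
    proof
      fix a
      show "\<sigma> a = \<tau> a"
      proof (cases "a \<in> {1..d}")
        case True
        with eq have "L ! (\<sigma> a - 1) = L ! (\<tau> a - 1)" by (simp add: map_eq_conv del: upt_Suc)
        with True show ?thesis
          using inj permutes_in_image[OF \<sigma>] permutes_in_image[OF \<tau>] by (auto dest: inj_onD)
      next
        case False
        then show ?thesis using \<sigma> \<tau> by (simp add: permutes_def)
      qed
    qed
  qed
  moreover have "card ?P = card ?Q"
    using assms by (simp add: card_permutations)
  ultimately have "?f ` ?P = ?Q"
    by (intro card_subset_eq) (simp_all add: card_image)
  with \<open>inj_on ?f ?P\<close> show ?thesis
    by (simp add: bij_betw_def)
qed

lemma minor_permutes:
  fixes I :: "nat set" and q :: "'k::field"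
  assumes "finite I"
  shows "minor q I = (\<Sum>\<sigma> | \<sigma> permutes {1..card I}.
    ((- q) powi (- int (inversion_number (card I) \<sigma>))) *\<^sub>s
      mon (map (\<lambda>a. (sorted_list_of_set I ! (\<sigma> a - 1), a)) [1..<card I + 1]))"
proof -
  let ?d = "card I" and ?L = "sorted_list_of_set I"
  let ?f = "\<lambda>\<sigma>. map (\<lambda>a. ?L ! (\<sigma> a - 1)) [1..<?d + 1]"
  have L: "?L ! (x - 1) < ?L ! (y - 1) \<longleftrightarrow> x < y" if "x \<in> {1..?d}" "y \<in> {1..?d}" for x y
  proof -
    have *: "?L ! (x - 1) < ?L ! (y - 1)" if "x < y" "x \<in> {1..?d}" "y \<in> {1..?d}" for x y
      by (rule sorted_wrt_nth_less[OF strict_sorted_list_of_set[of I]]) (use that in \<open>auto simp: diff_less_mono less_diff_conv2\<close>)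
    show ?thesis
      using *[OF _ that] *[OF _ that(2,1)] by (cases x y rule: linorder_cases) (auto dest: less_asym)
  qed
  have "inverse (- q) ^ inversions (?f \<sigma>) *\<^sub>s row_word 1 (?f \<sigma>) =
      ((- q) powi (- int (inversion_number ?d \<sigma>))) *\<^sub>s mon (map (\<lambda>a. (?L ! (\<sigma> a - 1), a)) [1..<?d + 1])"
    if \<sigma>: "\<sigma> permutes {1..?d}" for \<sigma>
  proof -
    \<comment> \<open>The sorted enumeration of \<open>I\<close> is strictly increasing, so
      inversions of the list of rows are those of \<open>\<sigma>\<close>.\<close>
    have "inversions (?f \<sigma>) = inversion_number ?d \<sigma>"
      unfolding inversions_map_upt inversion_number_def
      using permutes_in_image[OF \<sigma>] L by (intro arg_cong[of _ _ card]) auto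
    moreover have "zip (?f \<sigma>) [1..<1 + length (?f \<sigma>)] = map (\<lambda>a. (?L ! (\<sigma> a - 1), a)) [1..<?d + 1]"
      by (simp add: zip_map1 zip_same_conv_map del: upt_Suc)
    moreover have "inverse (- q) ^ m = (- q) powi (- int m)" for m
      by (simp only: power_int_minus power_int_of_nat power_inverse)
    ultimately show ?thesis
      by (simp only: row_word_def)
  qed
  then show ?thesis
    unfolding minor_def
    by (subst sum.reindex_bij_betw[OF permutes_list_bij[OF assms], symmetric]) (intro sum.cong, auto)
qed

lemma minor_in_carrier:
  assumes "I \<subseteq> {1..n}"
  shows "minor q I \<in> carrier (free_matrix_algebra n)"
proof -
  have n: "card I \<le> n"
    using card_mono[OF _ assms] by simp
  have "row_word 1 r \<in> carrier (free_matrix_algebra n)" if r: "r \<in> permutations_of_set I" for r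
    unfolding row_word_def
    using n assms permutations_of_setD(1)[OF r] length_finite_permutations_of_set[OF r]
    by (intro mon_in_free_algebra) (force dest: set_zip_leftD set_zip_rightD)
  then show ?thesis
    unfolding minor_def by (intro sum_in_free_algebra free_algebra_scale)
qed

text \<open>The projection respects products, scalars and finite sums, so the minor can be computed
  on representatives, where \<open>minor_permutes\<close> applies.\<close>

lemma quantum_minor_Mq:
  fixes q :: "'k::field"
  assumes I: "I \<subseteq> {1..n}"
  shows "quantum_minor (Mq n q) q (Mq_gen n q) I = q_ideal n q +>\<^bsub>free_matrix_algebra n\<^esub> minor q I"
proof -
  let ?F = "free_matrix_algebra n :: ('k, _) module" and ?I = "q_ideal n q"
  let ?\<pi> = "\<lambda>f. ?I +>\<^bsub>?F\<^esub> f" and ?L = "sorted_list_of_set I"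
  interpret ideal ?I ?F by (rule ideal_q_ideal)
  interpret M: ring "Mq n q" by (rule ring_Mq)
  note [simp del] = free_algebra_simps(1) One_nat_def
  have fin: "finite I" and n: "card I \<le> n"
    using I card_mono[OF _ I] by (auto intro: finite_subset)
  have mult: "?\<pi> f \<otimes>\<^bsub>Mq n q\<^esub> ?\<pi> g = ?\<pi> (f * g)" and add: "?\<pi> f \<oplus>\<^bsub>Mq n q\<^esub> ?\<pi> g = ?\<pi> (f + g)"
    if "f \<in> carrier ?F" "g \<in> carrier ?F" for f g
    using rcoset_mult_add[OF that] a_rcos_sum[OF that] by (simp_all add: Mq_def FactRing_def)
  have one: "\<one>\<^bsub>Mq n q\<^esub> = ?\<pi> 1"
    by (simp add: Mq_def FactRing_def)
  have zero: "\<zero>\<^bsub>Mq n q\<^esub> = ?\<pi> 0"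
    using a_rcos_zero[OF ideal_axioms additive_subgroup.zero_closed[OF is_additive_subgroup]]
    by (simp add: Mq_def FactRing_def)
  have carrier: "?\<pi> f \<in> carrier (Mq n q)" if "f \<in> carrier ?F" for f
    using that by (auto simp: Mq_def FactRing_def A_RCOSETS_def RCOSETS_def a_r_coset_def)
  have word: "mon (map (\<lambda>a. (h a, a)) as) \<in> carrier ?F"
    if "set as \<subseteq> {1..n}" "h ` set as \<subseteq> {1..n}" for h :: "nat \<Rightarrow> nat" and as
    using that by (intro mon_in_free_algebra) auto
  have prod: "foldr (\<lambda>a p. Mq_gen n q (h a) a \<otimes>\<^bsub>Mq n q\<^esub> p) as \<one>\<^bsub>Mq n q\<^esub> = ?\<pi> (mon (map (\<lambda>a. (h a, a)) as))"
    if "set as \<subseteq> {1..n}" "h ` set as \<subseteq> {1..n}" for h :: "nat \<Rightarrow> nat" and as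
    using that
  proof (induction as)
    case (Cons a as)
    then have "letter (h a, a) \<in> carrier ?F" "mon (map (\<lambda>a. (h a, a)) as) \<in> carrier ?F"
      by (intro letter_in_carrier word; simp)+
    from mult[OF this] show ?case
      using Cons by (simp add: Mq_gen_def mon_Cons)
  qed (simp add: one)
  have sum: "(\<Oplus>\<^bsub>Mq n q\<^esub>\<sigma>\<in>A. ?\<pi> (f \<sigma>)) = ?\<pi> (sum f A)"
    if "finite A" "\<And>\<sigma>. \<sigma> \<in> A \<Longrightarrow> f \<sigma> \<in> carrier ?F" for A :: "(nat \<Rightarrow> nat) set" and f
    using that
  proof (induction A rule: finite_induct)
    case (insert \<sigma> A)
    then have f: "f \<sigma> \<in> carrier ?F" "sum f A \<in> carrier ?F"
      by (blast intro: sum_in_free_algebra)+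
    have "(\<Oplus>\<^bsub>Mq n q\<^esub>\<sigma>\<in>insert \<sigma> A. ?\<pi> (f \<sigma>)) = ?\<pi> (f \<sigma>) \<oplus>\<^bsub>Mq n q\<^esub> (\<Oplus>\<^bsub>Mq n q\<^esub>\<sigma>\<in>A. ?\<pi> (f \<sigma>))"
      using insert.hyps insert.prems f carrier by (intro M.finsum_insert) blast+
    with add[OF f] insert show ?case by simp
  qed (simp add: zero)
  define T :: "(nat \<Rightarrow> nat) \<Rightarrow> (nat \<times> nat) word \<Rightarrow>\<^sub>0 'k" where
    "T = (\<lambda>\<sigma>. ((- q) powi (- int (inversion_number (card I) \<sigma>))) *\<^sub>s
      mon (map (\<lambda>a. (?L ! (\<sigma> a - 1), a)) [1..<card I + 1]))"
  have T: "T \<sigma> \<in> carrier ?F" "((- q) powi (- int (inversion_number (card I) \<sigma>))) \<odot>\<^bsub>Mq n q\<^esub>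
        foldr (\<lambda>a p. Mq_gen n q (?L ! (\<sigma> a - 1)) a \<otimes>\<^bsub>Mq n q\<^esub> p) [1..<card I + 1] \<one>\<^bsub>Mq n q\<^esub> = ?\<pi> (T \<sigma>)"
    if \<sigma>: "\<sigma> permutes {1..card I}" for \<sigma>
  proof -
    have "?L ! (\<sigma> a - 1) \<in> I" if "a \<in> {1..card I}" for a
    proof -
      have "\<sigma> a - 1 < length ?L" using permutes_in_image[OF \<sigma>, of a] that by auto
      from nth_mem[OF this] show ?thesis using fin by simp
    qed
    then have s: "set [1..<card I + 1] \<subseteq> {1..n}" "(\<lambda>a. ?L ! (\<sigma> a - 1)) ` set [1..<card I + 1] \<subseteq> {1..n}"
      using n I by auto
    show "T \<sigma> \<in> carrier ?F"
      unfolding T_def by (rule free_algebra_scale[OF word[OF s]])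
    show "((- q) powi (- int (inversion_number (card I) \<sigma>))) \<odot>\<^bsub>Mq n q\<^esub>
        foldr (\<lambda>a p. Mq_gen n q (?L ! (\<sigma> a - 1)) a \<otimes>\<^bsub>Mq n q\<^esub> p) [1..<card I + 1] \<one>\<^bsub>Mq n q\<^esub> = ?\<pi> (T \<sigma>)"
      unfolding prod[OF s] T_def scale_def by (rule Mq_smult_coset[OF word[OF s]])
  qed
  have "quantum_minor (Mq n q) q (Mq_gen n q) I = (\<Oplus>\<^bsub>Mq n q\<^esub>\<sigma>\<in>{\<sigma>. \<sigma> permutes {1..card I}}. ?\<pi> (T \<sigma>))"
    unfolding quantum_minor_def by (rule M.finsum_cong') (use T carrier in auto)
  also have "\<dots> = ?\<pi> (\<Sum>\<sigma> | \<sigma> permutes {1..card I}. T \<sigma>)"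
    using T(1) by (intro sum finite_permutations) auto
  also have "(\<Sum>\<sigma> | \<sigma> permutes {1..card I}. T \<sigma>) = minor q I"
    unfolding T_def by (rule minor_permutes[OF fin, symmetric])
  finally show ?thesis .
qed

theorem theorem1:
  fixes q :: "'k::field_char_0" and n :: nat and I J :: "nat set"
  assumes "q \<noteq> 0"
    and "\<And>m::nat. m > 0 \<Longrightarrow> q ^ m \<noteq> 1"
    and "I \<subseteq> {1..n}" and "J \<subseteq> {1..n}"
    and "surrounds J I"
  shows "quantum_minor (Mq n q) q (Mq_gen n q) J \<otimes>\<^bsub>Mq n q\<^esub> quantum_minor (Mq n q) q (Mq_gen n q) I =
    (q powi surround_weight J I) \<odot>\<^bsub>Mq n q\<^esub>
      (quantum_minor (Mq n q) q (Mq_gen n q) I \<otimes>\<^bsub>Mq n q\<^esub> quantum_minor (Mq n q) q (Mq_gen n q) J)"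
proof -
  let ?F = "free_matrix_algebra n :: ('k, _) module" and ?I = "q_ideal n q"
  let ?\<pi> = "\<lambda>f. ?I +>\<^bsub>?F\<^esub> f" and ?c = "q powi surround_weight J I"
  interpret q_matrix q n by standard (rule assms(1))
  interpret ideal ?I ?F by (rule ideal_q_ideal)
  note [simp del] = free_algebra_simps(1) One_nat_def
  have fin: "finite I" "finite J" and n: "card I \<le> n"
    using assms(3,4) card_mono[OF _ assms(3)] by (auto intro: finite_subset)
  obtain J' J'' where split: "surround_split J I J' J''" and card: "card J \<le> card I"
    using assms(5) unfolding surrounds_def by blast
  have M: "minor q J \<in> carrier ?F" "minor q I \<in> carrier ?F"
    using assms(3,4) by (simp_all add: minor_in_carrier)
  have MM: "minor q J * minor q I \<in> carrier ?F" "minor q I * minor q J \<in> carrier ?F"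
    using M by (simp_all add: free_algebra_closed)
  have "qcomm (rels (I \<union> J)) ?c (minor q J) (minor q I)"
    using qcomm_surrounds[OF fin card n split] by (simp add: surround_weight_eq[OF fin card split])
  then have "qcomm (rels {1..n}) ?c (minor q J) (minor q I)"
    \<comment> \<open>The relation was derived among the rows of I and J alone; its relations are
      among those of the full matrix.\<close>
    by (rule qcomm_mono[OF rels_mono, rotated]) (use assms(3,4) in simp)
  then have "minor q J * minor q I - ?c *\<^sub>s (minor q I * minor q J) \<in> ?I"
    unfolding qcomm_def using M by (intro matrix_ideal_q_ideal free_algebra_closed free_algebra_scale)
  then have "minor q J * minor q I \<in> ?\<pi> (?c *\<^sub>s (minor q I * minor q J))"
    by (auto simp: a_r_coset_def r_coset_def intro!: bexI)
  then have "?\<pi> (minor q J * minor q I) = ?\<pi> (?c *\<^sub>s (minor q I * minor q J))"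
    using a_repr_independence free_algebra_scale[OF MM(2)] a_subgroup by metis
  moreover have mult: "?\<pi> f \<otimes>\<^bsub>Mq n q\<^esub> ?\<pi> g = ?\<pi> (f * g)" if "f \<in> carrier ?F" "g \<in> carrier ?F" for f g
    using rcoset_mult_add[OF that] by (simp add: Mq_def FactRing_def)
  note mult[OF M] mult[OF M(2,1)]
  moreover have "?c \<odot>\<^bsub>Mq n q\<^esub> ?\<pi> (minor q I * minor q J) = ?\<pi> (?c *\<^sub>s (minor q I * minor q J))"
    unfolding scale_def by (rule Mq_smult_coset[OF MM(2)])
  ultimately show ?thesis
    by (simp add: quantum_minor_Mq assms(3,4))
qed

end
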